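(* Let $G$ be a group acting properly and by graph isomorphisms on a connected graph $X$ equipped with an undirected $G$-invariant path system $\mathcal P$. Then there is a full contraction gauge $K_0$ such that for every contraction triple $\mathcal K=(K,n,\mathcal P)$ with $K\ge K_0$ pointwise, the induced action of $G$ on the contraction space $\hat X_{\mathcal K}$ is non-uniformly acylindrical.
   Context: Graphs carry the path metric $d$ with edges of length 1. A $(\lambda,\kappa)$-quasi-geodesic ($\lambda\ge1,\kappa\ge0$) is a map $\gamma:I\to X$, $I\subseteq\mathbb R$ an interval, with $\frac1\lambda|t_1-t_2|-\kappa\le d(\gamma(t_1),\gamma(t_2))\le\lambda|t_1-t_2|+\kappa$. Convention: quasi-geodesics in $X$ are improved, i.e. continuous and such that the length of $\gamma|_{[t,t']}$ is at most $k_1d(\gamma(t),\gamma(t'))+k_2$, where $\kappa'=2(\lambda+\kappa)$, $k_1=\lambda(\lambda+\kappa)$, $k_2=(\lambda\kappa'+3)(\lambda+\kappa)$. For $p:[a,b]\to X$: $p^-=p(a)$, $p^+=p(b)$, $|p|=b-a$, the midpoint is the image of $(a+b)/2$, $p^{-1}$ is the reversed path. A path system $\mathcal P$ on $X$ is a set of quasi-geodesic segments, all $(\lambda_0,\kappa_0)$-quasi-geodesics for a common pair, containing all trivial paths, closed under passing to subsegments, and containing for all $x,y\in X$ a path from $x$ to $y$. Its elements are called special paths. It is undirected if closed under $h\mapsto h^{-1}$, and $G$-invariant if closed under $h\mapsto g\circ h$ for $g\in G$. An $(n,\mathcal P)$-polygonal line is a concatenation of at most $n$ special paths. A contraction gauge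 is a non-decreasing function $K:\mathbb R_{\ge0}\to\mathbb R_{\ge0}\cup\{\infty\}$; it is full if it never takes the value $\infty$. A contraction triple is $\mathcal K=(K,n,\mathcal P)$ with $K$ a contraction gauge and $n\ge7$ an integer. A special path $h$ is $\mathcal K$-midthin if for some $r\ge0$ one has $|h|\ge K(r)$ and every $(n,\mathcal P)$-polygonal line from $h^+$ to $h^-$ meets the closed $r$-ball around the midpoint of $h$. A special path is $\mathcal K$-anti-contracting if none of its subsegments is $\mathcal K$-midthin. A pair of vertices $(x,y)$ is $\mathcal K$-anti-contracting if some special path from $x$ to $y$ is $\mathcal K$-anti-contracting. $\hat X_{\mathcal K}$ is the graph, with path metric $\hat d_{\mathcal K}$, obtained from $X$ by adding an edge between every $\mathcal K$-anti-contracting pair of vertices; $G$ acts on it by graph isomorphisms since $\mathcal P$ is $G$-invariant. The action on $X$ is proper if $\{g: d(x,gx)\le r\}$ is finite for all $x\in X$, $r\ge0$. An action of $G$ on a metric space $(Y,d_Y)$ is non-uniformly acylindrical if for every $\epsilon>0$ there is $R>0$ such that for all $x,y\in Y$ with $d_Y(x,y)\ge R$ the set $\{g\in G: d_Y(x,gx)<\epsilon,\ d_Y(y,gy)<\epsilon\}$ is finite. *)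

theory Defs
  imports
    "HOL-Analysis.Analysis"
    "HOL-Algebra.Group_Action"
    "Graph_Theory.Bidirected_Digraph"
    "Graph_Theory.Digraph_Component"
begin

section \<open>Graphs as metric spaces\<close>

text \<open>
  Graphs are in the sense of Serre: an undirected edge is a pair of arcs \<open>e\<close>, \<open>rv e\<close> of a
  \<^locale>\<open>bidirected_digraph\<close>, so that infinite graphs, multiple edges and loops are all allowed.
  The point at parameter \<open>t\<close> in \<open>[0,1]\<close> on the arc \<open>e\<close> coincides with the point at parameter
  \<open>1 - t\<close> on \<open>rv e\<close>; an interior point of an edge is represented by the set of its two
  descriptions.
\<close>

datatype ('v, 'e) point = Vert 'v | Inner "('e \<times> real) set"

definition edge_point :: "('v, 'e) pre_digraph \<Rightarrow> ('e \<Rightarrow> 'e) \<Rightarrow> 'e \<Rightarrow> real \<Rightarrow> ('v, 'e) point" where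
  "edge_point X rv e t =
     (if t = 0 then Vert (tail X e)
      else if t = 1 then Vert (head X e)
      else Inner {(e, t), (rv e, 1 - t)})"

definition realization :: "('v, 'e) pre_digraph \<Rightarrow> ('e \<Rightarrow> 'e) \<Rightarrow> ('v, 'e) point set" where
  "realization X rv =
     Vert ` verts X \<union> {edge_point X rv e t | e t. e \<in> arcs X \<and> t \<in> {0..1}}"

text \<open>
  A piecewise linear path is a list of steps \<open>(e, s, t)\<close>, each moving along the arc \<open>e\<close> from
  parameter \<open>s\<close> to parameter \<open>t\<close>. The path metric is the infimum of the lengths of such paths;
  the default value 0 only concerns pairs of points that no path connects.
\<close>

fun pl_path :: "('v, 'e) pre_digraph \<Rightarrow> ('e \<Rightarrow> 'e) \<Rightarrow> ('v, 'e) point \<Rightarrow> ('e \<times> real \<times> real) list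
    \<Rightarrow> ('v, 'e) point \<Rightarrow> bool" where
  "pl_path X rv x [] y \<longleftrightarrow> x = y"
| "pl_path X rv x ((e, s, t) # ps) y \<longleftrightarrow>
     e \<in> arcs X \<and> s \<in> {0..1} \<and> t \<in> {0..1} \<and> x = edge_point X rv e s \<and>
     pl_path X rv (edge_point X rv e t) ps y"

definition pl_length :: "('e \<times> real \<times> real) list \<Rightarrow> real" where
  "pl_length ps = (\<Sum>(e, s, t)\<leftarrow>ps. \<bar>s - t\<bar>)"

definition path_metric :: "('v, 'e) pre_digraph \<Rightarrow> ('e \<Rightarrow> 'e) \<Rightarrow> ('v, 'e) point \<Rightarrow> ('v, 'e) point \<Rightarrow> real" where
  "path_metric X rv x y =
     (if \<exists>ps. pl_path X rv x ps y then Inf {pl_length ps | ps. pl_path X rv x ps y} else 0)"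

section \<open>Group actions\<close>

definition graph_action ::
  "('g, 'm) monoid_scheme \<Rightarrow> ('v, 'e) pre_digraph \<Rightarrow> ('e \<Rightarrow> 'e) \<Rightarrow> ('g \<Rightarrow> 'v \<Rightarrow> 'v) \<Rightarrow> ('g \<Rightarrow> 'e \<Rightarrow> 'e) \<Rightarrow> bool" where
  "graph_action G X rv av ae \<longleftrightarrow>
     group_action G (verts X) av \<and> group_action G (arcs X) ae \<and>
     (\<forall>g\<in>carrier G. \<forall>e\<in>arcs X.
        tail X (ae g e) = av g (tail X e) \<and>
        head X (ae g e) = av g (head X e) \<and>
        rv (ae g e) = ae g (rv e))"

fun point_act :: "('g \<Rightarrow> 'v \<Rightarrow> 'v) \<Rightarrow> ('g \<Rightarrow> 'e \<Rightarrow> 'e) \<Rightarrow> 'g \<Rightarrow> ('v, 'e) point \<Rightarrow> ('v, 'e) point" where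
  "point_act av ae g (Vert v) = Vert (av g v)"
| "point_act av ae g (Inner A) = Inner ((\<lambda>(e, t). (ae g e, t)) ` A)"

definition proper_action ::
  "('g, 'm) monoid_scheme \<Rightarrow> 'p set \<Rightarrow> ('p \<Rightarrow> 'p \<Rightarrow> real) \<Rightarrow> ('g \<Rightarrow> 'p \<Rightarrow> 'p) \<Rightarrow> bool" where
  "proper_action G M d act \<longleftrightarrow>
     (\<forall>x\<in>M. \<forall>r\<ge>0. finite {g \<in> carrier G. d x (act g x) \<le> r})"

definition nonuniformly_acylindrical ::
  "('g, 'm) monoid_scheme \<Rightarrow> 'p set \<Rightarrow> ('p \<Rightarrow> 'p \<Rightarrow> real) \<Rightarrow> ('g \<Rightarrow> 'p \<Rightarrow> 'p) \<Rightarrow> bool" where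
  "nonuniformly_acylindrical G M d act \<longleftrightarrow>
     (\<forall>\<epsilon>>0. \<exists>R>0. \<forall>x\<in>M. \<forall>y\<in>M. d x y \<ge> R \<longrightarrow>
        finite {g \<in> carrier G. d x (act g x) < \<epsilon> \<and> d y (act g y) < \<epsilon>})"

section \<open>Quasi-geodesics\<close>

definition quasi_geodesic ::
  "'p set \<Rightarrow> ('p \<Rightarrow> 'p \<Rightarrow> real) \<Rightarrow> real \<Rightarrow> real \<Rightarrow> real set \<Rightarrow> (real \<Rightarrow> 'p) \<Rightarrow> bool" where
  "quasi_geodesic M d l k I c \<longleftrightarrow>
     l \<ge> 1 \<and> k \<ge> 0 \<and> is_interval I \<and> c \<in> I \<rightarrow> M \<and>
     (\<forall>s\<in>I. \<forall>t\<in>I. (1 / l) * \<bar>s - t\<bar> - k \<le> d (c s) (c t) \<and> d (c s) (c t) \<le> l * \<bar>s - t\<bar> + k)"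

text \<open>The length of \<open>c\<close> on \<open>[s,t]\<close>, as a supremum over finite subdivisions.\<close>

definition curve_length :: "('p \<Rightarrow> 'p \<Rightarrow> real) \<Rightarrow> (real \<Rightarrow> 'p) \<Rightarrow> real \<Rightarrow> real \<Rightarrow> ennreal" where
  "curve_length d c s t =
     (SUP us \<in> {us. sorted us \<and> set us \<subseteq> {s..t}}.
        \<Sum>i<length us - 1. ennreal (d (c (us ! i)) (c (us ! Suc i))))"

definition improved_quasi_geodesic ::
  "'p set \<Rightarrow> ('p \<Rightarrow> 'p \<Rightarrow> real) \<Rightarrow> real \<Rightarrow> real \<Rightarrow> real set \<Rightarrow> (real \<Rightarrow> 'p) \<Rightarrow> bool" where
  "improved_quasi_geodesic M d l k I c \<longleftrightarrow>
     quasi_geodesic M d l k I c \<and>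
     continuous_map (top_of_set I) (Metric_space.mtopology M d) c \<and>
     (let k' = 2 * (l + k); k1 = l * (l + k); k2 = (l * k' + 3) * (l + k) in
       \<forall>s\<in>I. \<forall>t\<in>I. s \<le> t \<longrightarrow> curve_length d c s t \<le> ennreal (k1 * d (c s) (c t) + k2))"

section \<open>Path systems\<close>

text \<open>
  A map defined on \<open>[lo,hi]\<close>. Members of path systems are required to be \<^const>\<open>extensional\<close>
  there, so that equality of segments is equality of maps with the same domain.
\<close>

record 'p segment =
  lo :: real
  hi :: real
  smap :: "real \<Rightarrow> 'p"

definition segment_of :: "real \<Rightarrow> real \<Rightarrow> (real \<Rightarrow> 'p) \<Rightarrow> 'p segment" where
  "segment_of a b c = \<lparr>lo = a, hi = b, smap = restrict c {a..b}\<rparr>"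

definition initial :: "'p segment \<Rightarrow> 'p" where
  "initial p = smap p (lo p)"

definition final :: "'p segment \<Rightarrow> 'p" where
  "final p = smap p (hi p)"

definition extent :: "'p segment \<Rightarrow> real" where
  "extent p = hi p - lo p"

definition segment_midpoint :: "'p segment \<Rightarrow> 'p" where
  "segment_midpoint p = smap p ((lo p + hi p) / 2)"

definition segment_image :: "'p segment \<Rightarrow> 'p set" where
  "segment_image p = smap p ` {lo p..hi p}"

definition reversed :: "'p segment \<Rightarrow> 'p segment" where
  "reversed p = segment_of (lo p) (hi p) (\<lambda>t. smap p (lo p + hi p - t))"

definition subsegments :: "'p segment \<Rightarrow> 'p segment set" where
  "subsegments p = {segment_of s t (smap p) | s t. lo p \<le> s \<and> s \<le> t \<and> t \<le> hi p}"

definition path_system :: "'p set \<Rightarrow> ('p \<Rightarrow> 'p \<Rightarrow> real) \<Rightarrow> 'p segment set \<Rightarrow> bool" where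
  "path_system M d P \<longleftrightarrow>
     (\<exists>l k. \<forall>p\<in>P. lo p \<le> hi p \<and> smap p \<in> extensional {lo p..hi p} \<and>
        improved_quasi_geodesic M d l k {lo p..hi p} (smap p)) \<and>
     (\<forall>a. \<forall>x\<in>M. segment_of a a (\<lambda>_. x) \<in> P) \<and>
     (\<forall>p\<in>P. subsegments p \<subseteq> P) \<and>
     (\<forall>x\<in>M. \<forall>y\<in>M. \<exists>p\<in>P. initial p = x \<and> final p = y)"

definition undirected :: "'p segment set \<Rightarrow> bool" where
  "undirected P \<longleftrightarrow> (\<forall>p\<in>P. reversed p \<in> P)"

definition invariant_system ::
  "('g, 'm) monoid_scheme \<Rightarrow> ('g \<Rightarrow> 'p \<Rightarrow> 'p) \<Rightarrow> 'p segment set \<Rightarrow> bool" where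
  "invariant_system G act P \<longleftrightarrow>
     (\<forall>g\<in>carrier G. \<forall>p\<in>P. segment_of (lo p) (hi p) (act g \<circ> smap p) \<in> P)"

text \<open>
  A polygonal line is given by its consecutive pieces; its image is the union of their images,
  whichever parametrization of the concatenation is chosen.
\<close>

definition polygonal_line :: "nat \<Rightarrow> 'p segment set \<Rightarrow> 'p \<Rightarrow> 'p \<Rightarrow> 'p segment list \<Rightarrow> bool" where
  "polygonal_line n P x y ps \<longleftrightarrow>
     ps \<noteq> [] \<and> length ps \<le> n \<and> set ps \<subseteq> P \<and>
     initial (hd ps) = x \<and> final (last ps) = y \<and>
     successively (\<lambda>p q. final p = initial q) ps"

section \<open>Contraction spaces\<close>

text \<open>Only the values of a gauge on the nonnegative reals are relevant.\<close>

definition contraction_gauge :: "(real \<Rightarrow> ennreal) \<Rightarrow> bool" where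
  "contraction_gauge K \<longleftrightarrow> mono_on {0..} K"

definition full_gauge :: "(real \<Rightarrow> ennreal) \<Rightarrow> bool" where
  "full_gauge K \<longleftrightarrow> (\<forall>r\<ge>0. K r \<noteq> \<infinity>)"

definition contraction_triple ::
  "'p set \<Rightarrow> ('p \<Rightarrow> 'p \<Rightarrow> real) \<Rightarrow> (real \<Rightarrow> ennreal) \<Rightarrow> nat \<Rightarrow> 'p segment set \<Rightarrow> bool" where
  "contraction_triple M d K n P \<longleftrightarrow> contraction_gauge K \<and> n \<ge> 7 \<and> path_system M d P"

definition midthin ::
  "'p set \<Rightarrow> ('p \<Rightarrow> 'p \<Rightarrow> real) \<Rightarrow> (real \<Rightarrow> ennreal) \<Rightarrow> nat \<Rightarrow> 'p segment set \<Rightarrow> 'p segment \<Rightarrow> bool" where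
  "midthin M d K n P h \<longleftrightarrow>
     h \<in> P \<and>
     (\<exists>r\<ge>0. ennreal (extent h) \<ge> K r \<and>
        (\<forall>ps. polygonal_line n P (final h) (initial h) ps \<longrightarrow>
           (\<Union>p\<in>set ps. segment_image p) \<inter> Metric_space.mcball M d (segment_midpoint h) r \<noteq> {}))"

definition anti_contracting ::
  "'p set \<Rightarrow> ('p \<Rightarrow> 'p \<Rightarrow> real) \<Rightarrow> (real \<Rightarrow> ennreal) \<Rightarrow> nat \<Rightarrow> 'p segment set \<Rightarrow> 'p segment \<Rightarrow> bool" where
  "anti_contracting M d K n P h \<longleftrightarrow> h \<in> P \<and> (\<forall>q\<in>subsegments h. \<not> midthin M d K n P q)"

definition anti_contracting_pair ::
  "('v, 'e) pre_digraph \<Rightarrow> ('e \<Rightarrow> 'e) \<Rightarrow> (real \<Rightarrow> ennreal) \<Rightarrow> nat \<Rightarrow> ('v, 'e) point segment set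
    \<Rightarrow> 'v \<Rightarrow> 'v \<Rightarrow> bool" where
  "anti_contracting_pair X rv K n P x y \<longleftrightarrow>
     x \<in> verts X \<and> y \<in> verts X \<and>
     (\<exists>h\<in>P. initial h = Vert x \<and> final h = Vert y \<and>
        anti_contracting (realization X rv) (path_metric X rv) K n P h)"

text \<open>
  One new edge, i.e. the two arcs \<open>Inr (x, y)\<close> and \<open>Inr (y, x)\<close>, is added for each
  pair of distinct vertices that is anti-contracting. (For undirected path systems the
  anti-contracting pairs form a symmetric relation anyway.)
\<close>

definition contraction_graph ::
  "('v, 'e) pre_digraph \<Rightarrow> ('e \<Rightarrow> 'e) \<Rightarrow> (real \<Rightarrow> ennreal) \<Rightarrow> nat \<Rightarrow> ('v, 'e) point segment set
    \<Rightarrow> ('v, 'e + 'v \<times> 'v) pre_digraph" where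
  "contraction_graph X rv K n P =
     \<lparr>verts = verts X,
      arcs = Inl ` arcs X \<union>
        Inr ` {(x, y). x \<noteq> y \<and>
                 (anti_contracting_pair X rv K n P x y \<or> anti_contracting_pair X rv K n P y x)},
      tail = case_sum (tail X) fst,
      head = case_sum (head X) snd\<rparr>"

text \<open>\<^locale>\<open>bidirected_digraph\<close> requires the reversal map to fix everything that is not an arc.\<close>

definition contraction_rev ::
  "('v, 'e) pre_digraph \<Rightarrow> ('e \<Rightarrow> 'e) \<Rightarrow> (real \<Rightarrow> ennreal) \<Rightarrow> nat \<Rightarrow> ('v, 'e) point segment set
    \<Rightarrow> 'e + 'v \<times> 'v \<Rightarrow> 'e + 'v \<times> 'v" where
  "contraction_rev X rv K n P a =
     (if a \<in> arcs (contraction_graph X rv K n P) then map_sum rv prod.swap a else a)"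

definition contraction_arc_act ::
  "('g \<Rightarrow> 'v \<Rightarrow> 'v) \<Rightarrow> ('g \<Rightarrow> 'e \<Rightarrow> 'e) \<Rightarrow> 'g \<Rightarrow> 'e + 'v \<times> 'v \<Rightarrow> 'e + 'v \<times> 'v" where
  "contraction_arc_act av ae g = map_sum (ae g) (map_prod (av g) (av g))"

end

theory Submission
  imports Defs
begin

text \<open>
  A midthin subsegment of a special path \<open>h\<close> is a bottleneck: a polygonal line that closes up \<open>h\<close>
  with few pieces passes near its midpoint, at a distance that is tiny compared to the length of the
  subsegment, because the gauge \<open>K\<^sub>0\<close> is linear with a large slope.
  Minimising distances between sides of a polygon and looking at bottlenecks of the special path
  realising the minimum shows that triangles of special paths are uniformly thin in the contraction
  space, and hence that a special path between points of bounded distance there stays in a bounded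
  neighbourhood.

  Let \<open>g\<close> move two far apart points \<open>x\<close> and \<open>y\<close> by less than \<open>\<epsilon>\<close> in the contraction space. A
  special path \<open>h\<close> from \<open>x\<close> to \<open>y\<close> has a bottleneck far away from \<open>x\<close> and \<open>y\<close>. If \<open>g h\<close> avoided
  a large ball of \<open>X\<close> around it, then the quadrilateral with vertices \<open>x\<close>, \<open>y\<close>, \<open>g y\<close>, \<open>g x\<close> would
  behave there like a triangle without the side \<open>g h\<close>, and the bottleneck would be close in the
  contraction space to one of the short sides. So \<open>g h\<close> meets a ball depending only on \<open>x\<close> and
  \<open>y\<close>, which leaves finitely many \<open>g\<close> by properness.
\<close>

section \<open>Special paths and polygonal lines\<close>

text \<open>A bottleneck speaks only about closed polygons with boundedly many special sides, so
  each argument closes up the same path in two different ways; \<open>linked\<close> records just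
  what such a loop needs, the number of its pieces and a set containing them. The two loops yield
  two points near the bottleneck. If these lie on one quasi-geodesic, before and after an endpoint
  of the closed path, that endpoint is itself near the bottleneck; if they lie on the two sets whose
  distance is being minimised, they are a shortcut. Either way the bottleneck is too close to an end
  of its path. The losses are linear in the radius \<open>r\<close>, with coefficients depending
  only on the quasi-geodesic constants, which is why a linear gauge can exclude them all at once.
  The radius of a bottleneck is not controlled by distances in the contraction space. The ball
  around it therefore depends on the chosen points, and properness gives finiteness of the set of
  \<open>g\<close> without a common bound on its size.\<close>

definition linked :: "nat \<Rightarrow> 'p segment set \<Rightarrow> 'p set \<Rightarrow> 'p \<Rightarrow> 'p \<Rightarrow> bool" where
  "linked j P B x y \<longleftrightarrow>
     (\<exists>ps. polygonal_line j P x y ps \<and> (\<Union>p\<in>set ps. segment_image p) \<subseteq> B)"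

lemma linked_append:
  assumes "linked i P B x y" "linked j P C y z"
  shows "linked (i + j) P (B \<union> C) x z"
proof -
  obtain ps qs where ps: "polygonal_line i P x y ps" "(\<Union>p\<in>set ps. segment_image p) \<subseteq> B"
    and qs: "polygonal_line j P y z qs" "(\<Union>p\<in>set qs. segment_image p) \<subseteq> C"
    using assms unfolding linked_def by blast
  have "polygonal_line (i + j) P x z (ps @ qs)"
    using ps(1) qs(1) unfolding polygonal_line_def by (auto simp: successively_append_iff)
  moreover have "(\<Union>p\<in>set (ps @ qs). segment_image p) \<subseteq> B \<union> C"
    using ps(2) qs(2) by auto
  ultimately show ?thesis unfolding linked_def by blast
qed

lemma linked_mono:
  assumes "linked i P B x y" "i \<le> j" "B \<subseteq> C"
  shows "linked j P C x y"
proof -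
  obtain ps where "polygonal_line i P x y ps" "(\<Union>p\<in>set ps. segment_image p) \<subseteq> B"
    using assms(1) unfolding linked_def by blast
  then have "polygonal_line j P x y ps" "(\<Union>p\<in>set ps. segment_image p) \<subseteq> C"
    using assms(2,3) unfolding polygonal_line_def by auto
  then show ?thesis unfolding linked_def by blast
qed

lemma linked_segment:
  assumes "p \<in> P"
  shows "linked 1 P (segment_image p) (initial p) (final p)"
proof -
  have "polygonal_line 1 P (initial p) (final p) [p]"
    using assms by (simp add: polygonal_line_def)
  then show ?thesis
    unfolding linked_def by force
qed

lemma segment_of_simps [simp]:
  "lo (segment_of a b f) = a" "hi (segment_of a b f) = b"
  "t \<in> {a..b} \<Longrightarrow> smap (segment_of a b f) t = f t"
  by (auto simp: segment_of_def)

lemma reversed_simps: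
  assumes "lo p \<le> hi p"
  shows "initial (reversed p) = final p" "final (reversed p) = initial p"
    "segment_image (reversed p) = segment_image p"
proof -
  show "initial (reversed p) = final p" "final (reversed p) = initial p"
    using assms by (auto simp: reversed_def initial_def final_def)
  have "(\<lambda>t. lo p + hi p - t) ` {lo p..hi p} = {lo p..hi p}"
    by (auto simp: image_iff intro!: bexI[of _ "lo p + hi p - _"])
  then have "(\<lambda>t. smap p (lo p + hi p - t)) ` {lo p..hi p} = smap p ` {lo p..hi p}"
    by (metis (no_types) image_image)
  then show "segment_image (reversed p) = segment_image p"
    unfolding segment_image_def by (simp add: reversed_def)
qed

lemma segment_of_segment_of:
  assumes "a \<le> s" "t \<le> b"
  shows "segment_of s t (smap (segment_of a b f)) = segment_of s t f"
  using assms by (auto simp: segment_of_def fun_eq_iff restrict_def)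

section \<open>Quasi-geodesic estimates in an undirected path system\<close>

locale path_space = Metric_space M d
  for M :: "'p set" and d :: "'p \<Rightarrow> 'p \<Rightarrow> real" +
  fixes P :: "'p segment set" and l k :: real
  assumes l_ge_1: "1 \<le> l" and k_nonneg: "0 \<le> k"
    and lo_le_hi: "p \<in> P \<Longrightarrow> lo p \<le> hi p"
    and extensional: "p \<in> P \<Longrightarrow> smap p \<in> extensional {lo p..hi p}"
    and smap_in: "p \<in> P \<Longrightarrow> t \<in> {lo p..hi p} \<Longrightarrow> smap p t \<in> M"
    and lower: "p \<in> P \<Longrightarrow> s \<in> {lo p..hi p} \<Longrightarrow> t \<in> {lo p..hi p} \<Longrightarrow>
      (1 / l) * \<bar>s - t\<bar> - k \<le> d (smap p s) (smap p t)"
    and upper: "p \<in> P \<Longrightarrow> s \<in> {lo p..hi p} \<Longrightarrow> t \<in> {lo p..hi p} \<Longrightarrow>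
      d (smap p s) (smap p t) \<le> l * \<bar>s - t\<bar> + k"
    and const_in: "x \<in> M \<Longrightarrow> segment_of a a (\<lambda>_. x) \<in> P"
    and sub_in: "p \<in> P \<Longrightarrow> subsegments p \<subseteq> P"
    and joined: "x \<in> M \<Longrightarrow> y \<in> M \<Longrightarrow> \<exists>p\<in>P. initial p = x \<and> final p = y"
    and rev_in: "p \<in> P \<Longrightarrow> reversed p \<in> P"
begin

text \<open>One constant that absorbs \<open>l\<close>, \<open>k\<close>, \<open>l\<^sup>2\<close>
  and \<open>l\<^sup>2 * k\<close>, so that later bounds are multiples of \<open>q\<close> and
  \<open>q\<^sup>2\<close>.\<close>

definition q :: real where "q = l\<^sup>2 * (1 + k)"

lemma q_bounds: "1 \<le> q" "k \<le> q" "l \<le> q" "l\<^sup>2 \<le> q" "l\<^sup>2 * k \<le> q"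
proof -
  have l2: "1 \<le> l\<^sup>2" "l \<le> l\<^sup>2"
    using l_ge_1 mult_mono[of 1 l 1 l] mult_left_mono[of 1 l l] by (auto simp: power2_eq_square)
  have q: "q = l\<^sup>2 + l\<^sup>2 * k" by (simp add: q_def algebra_simps)
  have "1 * k \<le> l\<^sup>2 * k" using l2 k_nonneg by (intro mult_right_mono) auto
  then show "1 \<le> q" "k \<le> q" "l \<le> q" "l\<^sup>2 \<le> q" "l\<^sup>2 * k \<le> q"
    using l2 k_nonneg q by auto
qed

lemma initial_in: "p \<in> P \<Longrightarrow> initial p \<in> segment_image p"
  and final_in: "p \<in> P \<Longrightarrow> final p \<in> segment_image p"
  using lo_le_hi by (auto simp: initial_def final_def segment_image_def)

lemma image_in: "p \<in> P \<Longrightarrow> segment_image p \<subseteq> M"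
  using smap_in by (auto simp: segment_image_def)

lemma segment_of_in:
  "p \<in> P \<Longrightarrow> lo p \<le> s \<Longrightarrow> s \<le> t \<Longrightarrow> t \<le> hi p \<Longrightarrow> segment_of s t (smap p) \<in> P"
  using sub_in by (auto simp: subsegments_def)

lemma segment_of_whole: "p \<in> P \<Longrightarrow> segment_of (lo p) (hi p) (smap p) = p"
  using extensional[of p] by (simp add: segment_of_def extensional_restrict)

text \<open>\<open>min\<close> and \<open>max\<close> make the arc independent of the direction of
  travel; undirectedness of the system allows both directions.\<close>

definition part :: "'p segment \<Rightarrow> real \<Rightarrow> real \<Rightarrow> 'p set" where
  "part p s t = smap p ` {min s t..max s t}"

lemma linked_arc:
  assumes "p \<in> P" "s \<in> {lo p..hi p}" "t \<in> {lo p..hi p}"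
  shows "linked 1 P (part p s t) (smap p s) (smap p t)"
proof -
  have *: "linked 1 P (part p u v) (smap p u) (smap p v) \<and> linked 1 P (part p u v) (smap p v) (smap p u)"
    if "u \<le> v" "u \<in> {lo p..hi p}" "v \<in> {lo p..hi p}" for u v
  proof -
    let ?s = "segment_of u v (smap p)"
    have s: "?s \<in> P" using segment_of_in assms that by auto
    have im: "segment_image ?s = part p u v" "initial ?s = smap p u" "final ?s = smap p v"
      using that by (auto simp: segment_image_def part_def initial_def final_def image_def)
    show ?thesis
      using linked_segment[OF s] linked_segment[OF rev_in[OF s]] reversed_simps[of ?s] im that
      by simp
  qed
  show ?thesis
  proof (cases "s \<le> t")
    case False
    then have "part p s t = part p t s" by (simp add: part_def min.commute max.commute)
    then show ?thesis using *[of t s] False assms by simp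
  qed (use * assms in auto)
qed

lemma arc_sub: "p \<in> P \<Longrightarrow> s \<in> {lo p..hi p} \<Longrightarrow> t \<in> {lo p..hi p} \<Longrightarrow> part p s t \<subseteq> segment_image p"
  by (auto simp: part_def segment_image_def min_def max_def intro!: imageI split: if_splits)

lemma linked_arc_hi:
  assumes "p \<in> P" "t \<in> {lo p..hi p}"
  shows "linked 1 P (part p t (hi p)) (smap p t) (final p)"
    "linked 1 P (part p t (lo p)) (smap p t) (initial p)"
    "linked 1 P (part p (hi p) t) (final p) (smap p t)"
    "linked 1 P (part p (lo p) t) (initial p) (smap p t)"
  using assms linked_arc[of p] lo_le_hi[of p] by (auto simp: final_def initial_def)

lemma linked_rev:
  assumes "p \<in> P"
  shows "linked 1 P (segment_image p) (final p) (initial p)"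
  using linked_segment[OF rev_in[OF assms]] reversed_simps[of p] lo_le_hi[OF assms] by simp

text \<open>The lower quasi-geodesic bound makes \<open>t1\<close> and \<open>t3\<close> close,
  hence \<open>t2\<close> is close to \<open>t1\<close>, and the upper bound carries this back to
  \<open>M\<close>. It is used contrapositively: a special path cannot come near \<open>e\<close> on
  both sides of a point that is far from \<open>e\<close>.\<close>

lemma between:
  assumes p: "p \<in> P" and t: "t1 \<in> {lo p..hi p}" "t2 \<in> {lo p..hi p}" "t3 \<in> {lo p..hi p}"
    and "min t1 t3 \<le> t2" "t2 \<le> max t1 t3"
    and e: "e \<in> M" and 1: "d (smap p t1) e \<le> \<rho>" and 3: "d (smap p t3) e \<le> \<rho>"
  shows "d (smap p t2) e \<le> 3 * q * \<rho> + 2 * q"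
proof -
  have in_M: "smap p t1 \<in> M" "smap p t2 \<in> M" "smap p t3 \<in> M"
    using smap_in p t by auto
  have "0 \<le> \<rho>" using 1 nonneg order_trans by blast
  have "d (smap p t1) (smap p t3) \<le> 2 * \<rho>"
    using triangle[OF in_M(1) e in_M(3)] 1 3 commute[of e] by simp
  then have "(1 / l) * \<bar>t1 - t3\<bar> \<le> 2 * \<rho> + k"
    using lower[OF p t(1) t(3)] by linarith
  then have "\<bar>t1 - t3\<bar> \<le> l * (2 * \<rho> + k)"
    using l_ge_1 by (simp add: field_simps)
  then have "\<bar>t2 - t1\<bar> \<le> l * (2 * \<rho> + k)"
    using assms(5,6) by (auto simp: min_def max_def split: if_splits)
  then have "l * \<bar>t2 - t1\<bar> \<le> l * (l * (2 * \<rho> + k))"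
    using l_ge_1 by (intro mult_left_mono) auto
  also have "\<dots> = 2 * (l\<^sup>2 * \<rho>) + l\<^sup>2 * k" by (simp add: power2_eq_square algebra_simps)
  also have "\<dots> \<le> 2 * (q * \<rho>) + q"
    using q_bounds \<open>0 \<le> \<rho>\<close> mult_right_mono[of "l\<^sup>2" q \<rho>] by linarith
  finally have "d (smap p t2) (smap p t1) \<le> 2 * (q * \<rho>) + q + k"
    using upper[OF p t(2) t(1)] by linarith
  moreover have "1 * \<rho> \<le> q * \<rho>" using q_bounds \<open>0 \<le> \<rho>\<close> by (intro mult_right_mono) auto
  ultimately show ?thesis
    using triangle[OF in_M(2) in_M(1) e] 1 q_bounds by linarith
qed

text \<open>Close endpoints force a short parameter interval, so the path cannot stray. This
  controls special paths of which nothing but the endpoints is known.\<close>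

lemma near_initial:
  assumes p: "p \<in> P" and e: "e \<in> segment_image p"
  shows "d e (initial p) \<le> q * d (initial p) (final p) + 2 * q"
proof -
  obtain t where t: "t \<in> {lo p..hi p}" "e = smap p t" using e by (auto simp: segment_image_def)
  have hl: "lo p \<in> {lo p..hi p}" "hi p \<in> {lo p..hi p}" using lo_le_hi[OF p] by auto
  have "(1 / l) * \<bar>lo p - hi p\<bar> \<le> d (initial p) (final p) + k"
    using lower[OF p hl] by (simp add: initial_def final_def)
  then have *: "\<bar>lo p - hi p\<bar> \<le> l * (d (initial p) (final p) + k)"
    using l_ge_1 by (simp add: field_simps)
  have **: "l * \<tau> + k \<le> q * d (initial p) (final p) + 2 * q"
    if "\<tau> \<le> \<bar>lo p - hi p\<bar>" for \<tau>
  proof -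
    have "l * \<tau> \<le> l * (l * (d (initial p) (final p) + k))"
      using that * l_ge_1 by (intro mult_left_mono) auto
    also have "\<dots> = l\<^sup>2 * d (initial p) (final p) + l\<^sup>2 * k" by (simp add: power2_eq_square algebra_simps)
    also have "\<dots> \<le> q * d (initial p) (final p) + q"
      using q_bounds mult_right_mono[of "l\<^sup>2" q "d (initial p) (final p)"] nonneg by (intro add_mono) auto
    finally show ?thesis using q_bounds by linarith
  qed
  show "d e (initial p) \<le> q * d (initial p) (final p) + 2 * q"
    using **[of "\<bar>t - lo p\<bar>"] upper[OF p t(1) hl(1)] t by (simp add: initial_def)
qed

text \<open>
  Minimising the distance between the two sets with a penalty for moving away from \<open>m\<close> keeps
  the minimiser near \<open>m\<close>. The additive error 1 replaces compactness.
\<close>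

definition near_minimal :: "'p set \<Rightarrow> 'p set \<Rightarrow> 'p \<Rightarrow> 'p \<Rightarrow> bool" where
  "near_minimal S B x b \<longleftrightarrow> x \<in> S \<and> b \<in> B \<and>
     (\<forall>x'\<in>S. \<forall>b'\<in>B. d x b \<le> d x' b' + d x x' / (2 * q) + 1)"

lemma ex_near_minimal:
  assumes "S \<subseteq> M" "B \<subseteq> M" "m \<in> S" "n \<in> B"
  obtains x b where "near_minimal S B x b" "d x b \<le> d m n + 1" "d x m \<le> 2 * q * (d m n + 1)"
proof -
  define f where "f = (\<lambda>(x, b). d x b + d x m / (2 * q))"
  have f0: "0 \<le> f z" for z using q_bounds by (cases z) (simp add: f_def)
  define i where "i = Inf (f ` (S \<times> B))"
  have bdd: "bdd_below (f ` (S \<times> B))" using f0 by (auto intro!: bdd_belowI[of _ 0])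
  have ne: "f ` (S \<times> B) \<noteq> {}" using assms by auto
  obtain z where z: "z \<in> S \<times> B" "f z < i + 1"
    using cInf_lessD[OF ne, of "i + 1"] by (auto simp: i_def)
  obtain x b where xb: "z = (x, b)" "x \<in> S" "b \<in> B" using z by auto
  have le: "f (x, b) \<le> f (x', b') + 1" if "x' \<in> S" "b' \<in> B" for x' b'
  proof -
    have "i \<le> f (x', b')" unfolding i_def using that by (intro cInf_lower bdd) auto
    then show ?thesis using z xb by auto
  qed
  have *: "d x b + d x m / (2 * q) \<le> d m n + 1"
    using le[OF assms(3,4)] assms by (auto simp: f_def)
  show thesis
  proof
    show "near_minimal S B x b"
      unfolding near_minimal_def
    proof (intro conjI ballI)
      fix x' b' assume *: "x' \<in> S" "b' \<in> B"
      have "d x' m \<le> d x x' + d x m"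
        using triangle[of x' x m] * xb assms commute[of x x'] by auto
      then have "d x' m / (2 * q) \<le> (d x x' + d x m) / (2 * q)"
        using q_bounds by (intro divide_right_mono) auto
      then show "d x b \<le> d x' b' + d x x' / (2 * q) + 1"
        using le[OF *] by (simp add: f_def add_divide_distrib)
    qed (use xb in auto)
    have "0 \<le> d x m / (2 * q)" using q_bounds by simp
    then show "d x b \<le> d m n + 1" using * by linarith
    have "d x m / (2 * q) \<le> d m n + 1" using * nonneg[of x b] by linarith
    then show "d x m \<le> 2 * q * (d m n + 1)" using q_bounds by (simp add: field_simps)
  qed
qed

text \<open>If both sets come near a point \<open>e\<close> of \<open>s\<close>, then
  \<open>x'\<close>, \<open>b'\<close> compete with \<open>x\<close>, \<open>b\<close>. As
  \<open>x'\<close> is within about \<open>q * d x b\<close> of \<open>x\<close>, the penalty of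
  weight \<open>1 / (2 * q)\<close> costs only about half of \<open>d x b\<close> and is absorbed on
  the left. Hence \<open>d x b\<close> is bounded linearly in \<open>\<rho>\<close>, and so is the
  distance from \<open>e\<close> to \<open>x\<close>.\<close>

lemma near_minimal_gap:
  assumes min: "near_minimal S B x b" and sub: "S \<subseteq> M" "B \<subseteq> M"
    and s: "s \<in> P" "initial s = x" "final s = b" and e: "e \<in> segment_image s"
    and x': "x' \<in> S" "d x' e \<le> \<rho>" and b': "b' \<in> B" "d b' e \<le> \<rho>"
  shows "d e x \<le> 6 * q * \<rho> + 6 * q"
proof -
  have in_M: "x \<in> M" "b \<in> M" "e \<in> M" "x' \<in> M" "b' \<in> M"
    using min sub x' b' e image_in[OF s(1)] by (auto simp: near_minimal_def)
  have ex: "d e x \<le> q * d x b + 2 * q" using near_initial[OF s(1) e] s by simp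
  have "d x x' \<le> q * d x b + 2 * q + \<rho>"
    using triangle[of x e x'] in_M ex x' commute[of e x] commute[of e x'] by simp
  then have "d x x' / (2 * q) \<le> (q * d x b + 2 * q + \<rho>) / (2 * q)"
    using q_bounds by (intro divide_right_mono) auto
  also have "\<dots> = d x b / 2 + 1 + \<rho> / (2 * q)"
    using q_bounds by (simp add: field_simps)
  also have "\<rho> / (2 * q) \<le> \<rho>"
  proof -
    have "0 \<le> \<rho>" using x' nonneg order_trans by blast
    then show ?thesis using q_bounds mult_left_mono[of 1 "2*q" \<rho>] by (simp add: field_simps)
  qed
  finally have 1: "d x x' / (2 * q) \<le> d x b / 2 + 1 + \<rho>" by simp
  have "d x' b' \<le> 2 * \<rho>"
    using triangle[of x' e b'] in_M x' b' commute[of e b'] by simp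
  moreover have "d x b \<le> d x' b' + d x x' / (2 * q) + 1"
    using min x' b' by (auto simp: near_minimal_def)
  ultimately have "d x b \<le> 6 * \<rho> + 4" using 1 by linarith
  then have "q * d x b \<le> q * (6 * \<rho> + 4)" using q_bounds by (intro mult_left_mono) auto
  then show ?thesis using ex by (simp add: algebra_simps)
qed

text \<open>The constant 60 is dictated by the estimates of the next lemma.\<close>

definition gap :: "real \<Rightarrow> real" where "gap r = 60 * q\<^sup>2 * (r + 1)"

text \<open>The thresholds that a bottleneck has to beat. The radius \<open>8 * q * (r + 1)\<close>
  belongs to an enlarged ball around a first bottleneck, which swallows the balls of a second one.
  The sixth bound is the most demanding: its left side is at most
  \<open>54 * q\<^sup>2 * (r + 1)\<close>.\<close>

lemma gap_bounds:
  assumes "0 \<le> r"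
  shows "r < gap r" "0 < gap r" "3 * q * r + 2 * q < gap r" "6 * q * r + 6 * q < gap r"
    "3 * q * (8 * q * (r + 1)) + 2 * q < gap r" "6 * q * (8 * q * (r + 1)) + 6 * q < gap r"
    "2 * q * (r + 1) < gap r"
proof -
  define y where "y = q * r"
  define w where "w = q\<^sup>2 * r"
  define v where "v = q\<^sup>2"
  have "q \<le> v" using q_bounds mult_left_mono[of 1 q q] by (simp add: v_def power2_eq_square)
  then have le: "q \<le> v" "y \<le> w" "r \<le> y" "1 \<le> q"
    using q_bounds mult_right_mono[of 1 q r] mult_right_mono[of q v r] assms
    by (auto simp: y_def w_def v_def)
  have eq: "gap r = 60 * w + 60 * v" "3 * q * r + 2 * q = 3 * y + 2 * q"
    "6 * q * r + 6 * q = 6 * y + 6 * q"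
    "3 * q * (8 * q * (r + 1)) + 2 * q = 24 * w + 24 * v + 2 * q"
    "6 * q * (8 * q * (r + 1)) + 6 * q = 48 * w + 48 * v + 6 * q"
    "2 * q * (r + 1) = 2 * y + 2 * q"
    unfolding gap_def y_def w_def v_def by (simp_all add: power2_eq_square distrib_left)
  show "r < gap r" "0 < gap r" "3 * q * r + 2 * q < gap r" "6 * q * r + 6 * q < gap r"
    "3 * q * (8 * q * (r + 1)) + 2 * q < gap r" "6 * q * (8 * q * (r + 1)) + 6 * q < gap r"
    "2 * q * (r + 1) < gap r"
    unfolding eq using le assms by (simp_all add: y_def[symmetric])
qed

lemma between_arc:
  assumes p: "p \<in> P" and t: "t1 \<in> {lo p..hi p}" "t \<in> {lo p..hi p}" "t3 \<in> {lo p..hi p}"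
    and le: "t1 \<le> t" "t \<le> t3" and y: "y \<in> part p t t1" "y' \<in> part p t t3"
    and e: "e \<in> M" and near: "d y e \<le> \<rho>" "d y' e \<le> \<rho>"
  shows "d (smap p t) e \<le> 3 * q * \<rho> + 2 * q"
proof -
  obtain u u' where "y = smap p u" "t1 \<le> u" "u \<le> t" "y' = smap p u'" "t \<le> u'" "u' \<le> t3"
    using y le unfolding part_def by (auto simp: min_def max_def split: if_splits)
  then show ?thesis
    using between[OF p, of u t u' e \<rho>] t e near by (auto simp: min_def max_def)
qed

lemma anti_contracting_sub:
  assumes "anti_contracting M d K n P (segment_of a b f)" "a \<le> s" "s \<le> t" "t \<le> b"
  shows "anti_contracting M d K n P (segment_of s t f)"
proof -
  have "segment_of s t f \<in> P"
    using assms segment_of_in[of "segment_of a b f" s t] segment_of_segment_of[of a s t b f]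
    unfolding anti_contracting_def by simp
  moreover have "subsegments (segment_of s t f) \<subseteq> subsegments (segment_of a b f)"
  proof
    fix x assume "x \<in> subsegments (segment_of s t f)"
    then obtain s' t' where "x = segment_of s' t' (smap (segment_of s t f))"
      "s \<le> s'" "s' \<le> t'" "t' \<le> t"
      by (auto simp: subsegments_def)
    then have "x = segment_of s' t' (smap (segment_of a b f))" "a \<le> s'" "s' \<le> t'" "t' \<le> b"
      using assms segment_of_segment_of[of s s' t' t f] segment_of_segment_of[of a s' t' b f] by auto
    then show "x \<in> subsegments (segment_of a b f)" by (auto simp: subsegments_def)
  qed
  ultimately show ?thesis using assms(1) unfolding anti_contracting_def by blast
qed

end

section \<open>Bottlenecks and thin triangles\<close>

text \<open>\<open>D\<close> is later the metric of the contraction space pulled back to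
  \<open>M\<close>; the geometric argument sees it only through these properties. In the gauge, the
  factor 2 is there because the midpoint halves the extent, while \<open>l\<close> and
  \<open>k\<close> undo the lower quasi-geodesic bound; the outcome is a distance of at least
  \<open>gap r\<close> from the midpoint of a midthin segment to its ends.\<close>

locale contraction_setting = path_space M d P l k
  for M :: "'p set" and d P l k +
  fixes K :: "real \<Rightarrow> ennreal" and n :: nat and D :: "'p \<Rightarrow> 'p \<Rightarrow> real" and c :: real
  assumes gauge: "0 \<le> r \<Longrightarrow> ennreal (2 * l * (gap r + k)) \<le> K r"
    and n_ge: "7 \<le> n"
    and c_nonneg: "0 \<le> c"
    and D_triangle: "x \<in> M \<Longrightarrow> y \<in> M \<Longrightarrow> z \<in> M \<Longrightarrow> D x z \<le> D x y + D y z"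
    and D_commute: "x \<in> M \<Longrightarrow> y \<in> M \<Longrightarrow> D x y = D y x"
    and D_le: "x \<in> M \<Longrightarrow> y \<in> M \<Longrightarrow> D x y \<le> d x y"
    and D_anti: "anti_contracting M d K n P h \<Longrightarrow> D (initial h) (final h) \<le> c"
begin

abbreviation anti :: "'p segment \<Rightarrow> bool" where
  "anti \<equiv> anti_contracting M d K n P"

lemma D_anti_sub:
  assumes "anti (segment_of a b f)" "a \<le> s" "s \<le> t" "t \<le> b"
  shows "D (f s) (f t) \<le> c"
  using D_anti[OF anti_contracting_sub[OF assms]] assms by (simp add: initial_def final_def)

lemma D_self: "x \<in> M \<Longrightarrow> D x x \<le> 0"
  using D_le[of x x] mdist_zero by fastforce

text \<open>
  A bottleneck on \<open>s\<close> at parameter \<open>\<tau>\<close>: the rest of \<open>s\<close> is far away from \<open>s \<tau>\<close> compared to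
  \<open>r\<close>, so that a polygonal line closing up \<open>s\<close> has to come \<open>r\<close>-close itself. The remaining two
  of the seven pieces are the two ends of \<open>s\<close>.
\<close>

definition bottleneck :: "'p segment \<Rightarrow> real \<Rightarrow> real \<Rightarrow> real \<Rightarrow> real \<Rightarrow> bool" where
  "bottleneck s u0 u1 \<tau> r \<longleftrightarrow> u0 \<le> \<tau> \<and> \<tau> \<le> u1 \<and> 0 \<le> r \<and>
     (\<forall>t\<in>{lo s..hi s}. t \<le> u0 \<or> u1 \<le> t \<longrightarrow> gap r \<le> d (smap s \<tau>) (smap s t)) \<and>
     (\<forall>B. linked 5 P B (final s) (initial s) \<longrightarrow> (\<exists>z\<in>B. d z (smap s \<tau>) \<le> r))"

lemma gauge_pos:
  assumes "0 \<le> r"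
  shows "0 < 2 * l * (gap r + k)"
  using gap_bounds(2)[OF assms] l_ge_1 k_nonneg by simp

lemma midthin_extent:
  assumes "midthin M d K n P h"
  obtains r where "0 \<le> r" "2 * l * (gap r + k) \<le> extent h"
    "\<And>ps. polygonal_line n P (final h) (initial h) ps \<Longrightarrow>
      (\<Union>p\<in>set ps. segment_image p) \<inter> mcball (segment_midpoint h) r \<noteq> {}"
proof -
  obtain r where r: "0 \<le> r" "ennreal (extent h) \<ge> K r"
    "\<And>ps. polygonal_line n P (final h) (initial h) ps \<Longrightarrow>
      (\<Union>p\<in>set ps. segment_image p) \<inter> mcball (segment_midpoint h) r \<noteq> {}"
    using assms unfolding midthin_def by blast
  \<comment> \<open>\<open>ennreal\<close> clamps negative numbers to 0; positivity of the smaller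
    side is what lets the inequality descend to the reals.\<close>
  have pos: "0 < 2 * l * (gap r + k)"
    using gauge_pos[OF r(1)] by blast
  have "ennreal (2 * l * (gap r + k)) \<le> ennreal (extent h)"
    using gauge[OF r(1)] r(2) by (rule order_trans)
  then have "2 * l * (gap r + k) \<le> extent h"
    using pos by (auto simp: ennreal_le_iff2)
  then show thesis using r that by blast
qed

text \<open>The midpoint of a midthin subsegment serves. Adding the two leftover ends of
  \<open>s\<close> to a line that closes \<open>s\<close> gives a line that closes the subsegment;
  these ends stay farther than \<open>r\<close> from the midpoint, so the \<open>r\<close>-close
  point lies on the given line.\<close>

lemma ex_bottleneck:
  assumes s: "s \<in> P" and u: "lo s \<le> u0" "u0 \<le> u1" "u1 \<le> hi s"
    and not_anti: "\<not> anti (segment_of u0 u1 (smap s))"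
  obtains \<tau> r where "bottleneck s u0 u1 \<tau> r"
proof -
  obtain h where h: "h \<in> subsegments (segment_of u0 u1 (smap s))" "midthin M d K n P h"
    using not_anti segment_of_in[OF s u] unfolding anti_contracting_def by blast
  then obtain t0 t1 where "h = segment_of t0 t1 (smap (segment_of u0 u1 (smap s)))"
    and t': "u0 \<le> t0" "t0 \<le> t1" "t1 \<le> u1"
    by (auto simp: subsegments_def)
  then have t: "h = segment_of t0 t1 (smap s)" "u0 \<le> t0" "t0 \<le> t1" "t1 \<le> u1"
    by (simp_all add: segment_of_segment_of)
  obtain r where r: "0 \<le> r" "2 * l * (gap r + k) \<le> extent h"
    "\<And>ps. polygonal_line n P (final h) (initial h) ps \<Longrightarrow>
      (\<Union>p\<in>set ps. segment_image p) \<inter> mcball (segment_midpoint h) r \<noteq> {}"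
    by (rule midthin_extent[OF h(2)]) blast
  define \<tau> where "\<tau> = (t0 + t1) / 2"
  have h_pts: "final h = smap s t1" "initial h = smap s t0" "segment_midpoint h = smap s \<tau>"
    using t by (auto simp: final_def initial_def segment_midpoint_def \<tau>_def field_simps)
  have dom: "t0 \<in> {lo s..hi s}" "t1 \<in> {lo s..hi s}" "\<tau> \<in> {lo s..hi s}"
    using t u by (auto simp: \<tau>_def)
  have far: "gap r \<le> d (smap s \<tau>) (smap s t)"
    if "t \<in> {lo s..hi s}" "t \<le> t0 \<or> t1 \<le> t" for t
  proof -
    have "(t1 - t0) / 2 \<le> \<bar>\<tau> - t\<bar>"
      using that(2) t(3) by (auto simp: \<tau>_def abs_if field_simps)
    then have "extent h / 2 \<le> \<bar>\<tau> - t\<bar>" using t(1) by (simp add: extent_def)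
    then have "l * (gap r + k) \<le> \<bar>\<tau> - t\<bar>" using r(2) by linarith
    then have "gap r + k \<le> (1 / l) * \<bar>\<tau> - t\<bar>" using l_ge_1 by (simp add: field_simps)
    then show ?thesis using lower[OF s dom(3) that(1)] by linarith
  qed
  have "\<exists>z\<in>B. d z (smap s \<tau>) \<le> r" if B: "linked 5 P B (final s) (initial s)" for B
  proof -
    have "linked (1 + 5 + 1) P (part s t1 (hi s) \<union> B \<union> part s (lo s) t0) (final h) (initial h)"
      unfolding h_pts
      using linked_append[OF linked_append[OF linked_arc_hi(1)[OF s dom(2)] B] linked_arc_hi(4)[OF s dom(1)]] .
    then have "linked n P (part s t1 (hi s) \<union> B \<union> part s (lo s) t0) (final h) (initial h)"
      using n_ge by (elim linked_mono) auto
    then obtain ps where ps: "polygonal_line n P (final h) (initial h) ps"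
      "(\<Union>p\<in>set ps. segment_image p) \<subseteq> part s t1 (hi s) \<union> B \<union> part s (lo s) t0"
      unfolding linked_def by blast
    obtain z where z: "z \<in> (\<Union>p\<in>set ps. segment_image p)" "z \<in> mcball (segment_midpoint h) r"
      using r(3)[OF ps(1)] by blast
    have dz: "d z (smap s \<tau>) \<le> r" using z(2) h_pts commute[of z] by simp
    have "z \<notin> part s t1 (hi s)" "z \<notin> part s (lo s) t0"
    proof -
      have "r < d z (smap s \<tau>)" if "z = smap s t" "t \<in> {lo s..hi s}" "t \<le> t0 \<or> t1 \<le> t" for t
        using far[OF that(2,3)] gap_bounds(1)[OF r(1)] that(1) commute[of z] by simp
      then show "z \<notin> part s t1 (hi s)" "z \<notin> part s (lo s) t0"
        using dz t u by (auto simp: part_def not_le[symmetric])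
    qed
    then show ?thesis using z(1) ps(2) dz by blast
  qed
  then have "bottleneck s u0 u1 \<tau> r"
    using r(1) far t unfolding bottleneck_def by (auto simp: \<tau>_def)
  then show thesis using that by blast
qed

lemma anti_trivial:
  assumes "s \<in> P" "u \<in> {lo s..hi s}"
  shows "anti (segment_of u u (smap s))"
  unfolding anti_contracting_def
proof (intro conjI ballI)
  show "segment_of u u (smap s) \<in> P" using assms segment_of_in by auto
  fix h assume "h \<in> subsegments (segment_of u u (smap s))"
  then have h0: "extent h = 0" by (auto simp: subsegments_def extent_def)
  show "\<not> midthin M d K n P h"
  proof
    assume "midthin M d K n P h"
    then obtain r where "0 \<le> r" "2 * l * (gap r + k) \<le> 0"
      using midthin_extent h0 by metis
    moreover have "0 < 2 * l * (gap r + k)"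
      using gauge_pos[OF \<open>0 \<le> r\<close>] by blast
    ultimately show False by simp
  qed
qed

text \<open>The segment is lengthened in unit steps. The last anti-contracting stage costs
  \<open>c\<close> in \<open>D\<close>, the extra step \<open>l + k\<close>. So a bottleneck found
  in \<open>{u..u1}\<close> is \<open>D\<close>-close to the start, however long the segment
  is.\<close>

lemma first_not_anti:
  assumes s: "s \<in> P" and u: "u \<in> {lo s..hi s}"
    and not_anti: "\<not> anti (segment_of u (hi s) (smap s))"
  obtains u1 where "u \<le> u1" "u1 \<le> hi s" "\<not> anti (segment_of u u1 (smap s))"
    "\<And>t. t \<in> {u..u1} \<Longrightarrow> D (smap s u) (smap s t) \<le> c + l + k"
proof -
  define v where "v i = min (u + real i) (hi s)" for i
  obtain N where "hi s - u \<le> real N" using real_arch_simple by blast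
  then have "v N = hi s" by (simp add: v_def)
  define i where "i = (LEAST i. \<not> anti (segment_of u (v i) (smap s)))"
  have i: "\<not> anti (segment_of u (v i) (smap s))"
    unfolding i_def by (rule LeastI[of _ N]) (simp add: not_anti \<open>v N = hi s\<close>)
  have "v 0 = u" using u by (simp add: v_def)
  then have "i \<noteq> 0" using i anti_trivial[OF s u] by metis
  then obtain j where j: "i = Suc j" by (cases i) auto
  have aj: "anti (segment_of u (v j) (smap s))"
    using not_less_Least[of j "\<lambda>i. \<not> anti (segment_of u (v i) (smap s))"] j by (simp add: i_def)
  have uv: "u \<le> v j" "v j \<le> v i" "v i \<le> hi s" "v i \<le> v j + 1" using u by (auto simp: v_def j)
  show thesis
  proof
    fix t assume t: "t \<in> {u..v i}"
    show "D (smap s u) (smap s t) \<le> c + l + k"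
    proof (cases "t \<le> v j")
      case True
      then show ?thesis using D_anti_sub[OF aj, of u t] t l_ge_1 k_nonneg by auto
    next
      case False
      have dom: "v j \<in> {lo s..hi s}" "t \<in> {lo s..hi s}" using uv t u by auto
      have "d (smap s (v j)) (smap s t) \<le> l * \<bar>v j - t\<bar> + k" using upper[OF s dom] .
      also have "l * \<bar>v j - t\<bar> \<le> l * 1" using False t uv l_ge_1 by (intro mult_left_mono) auto
      finally have "D (smap s (v j)) (smap s t) \<le> l + k"
        using D_le[of "smap s (v j)" "smap s t"] smap_in[OF s] dom by fastforce
      moreover have "D (smap s u) (smap s (v j)) \<le> c" using D_anti_sub[OF aj] uv by auto
      ultimately show ?thesis
        using D_triangle[of "smap s u" "smap s (v j)" "smap s t"] smap_in[OF s] dom u by fastforce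
    qed
  qed (use i uv in auto)
qed

text \<open>
  Let \<open>s\<close> be a special path realising the distance from \<open>p1\<close> to \<open>p2 \<union> p3\<close> and ending on \<open>p2\<close>.
  At a bottleneck \<open>e\<close> of \<open>s\<close>, closing up \<open>s\<close> around either corner shows that \<open>p2\<close> passes near \<open>e\<close>
  before reaching \<open>b\<close>, while \<open>p1\<close> stays away from \<open>e\<close>. A second path \<open>s2\<close> realising the distance
  from \<open>s\<close> to \<open>p2 \<union> p3\<close> near \<open>e\<close> then has no bottleneck, since \<open>p2\<close> cannot come back from \<open>b\<close>
  to \<open>e\<close>. The side \<open>p4\<close> is either far away or degenerate.
\<close>

lemma near_minimal_hat_close:
  assumes P: "p1 \<in> P" "p2 \<in> P" "p3 \<in> P" "p4 \<in> P"
    and corners: "initial p1 = initial p2" "final p2 = initial p4" "final p4 = initial p3"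
      "final p3 = final p1"
    and min: "near_minimal (segment_image p1) (segment_image p2 \<union> segment_image p3) x b"
    and b: "b \<in> segment_image p2"
    and far: "\<And>z. z \<in> segment_image p4 \<Longrightarrow> d z x \<le> 40 * q\<^sup>2 * (d x b + 1) \<Longrightarrow>
      z = final p2 \<and> z = initial p3"
  shows "\<exists>b'\<in>segment_image p2 \<union> segment_image p3. D x b' \<le> 2 * c + l + k"
proof -
  let ?S = "segment_image p1" and ?Q = "segment_image p2 \<union> segment_image p3"
  have subM: "?S \<subseteq> M" "?Q \<subseteq> M" using image_in P by auto
  have xS: "x \<in> ?S" using min by (simp add: near_minimal_def)
  then obtain tx where tx: "tx \<in> {lo p1..hi p1}" "x = smap p1 tx" by (auto simp: segment_image_def)
  obtain tb where tb: "tb \<in> {lo p2..hi p2}" "b = smap p2 tb" using b by (auto simp: segment_image_def)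
  have xM: "x \<in> M" and bM: "b \<in> M" using xS b subM by auto
  obtain s where s: "s \<in> P" "initial s = x" "final s = b" using joined[OF xM bM] by blast
  have whole: "segment_of (lo s) (hi s) (smap s) = s" by (rule segment_of_whole[OF s(1)])
  have los: "lo s \<in> {lo s..hi s}" "hi s \<in> {lo s..hi s}" using lo_le_hi[OF s(1)] by auto
  show ?thesis
  proof (cases "anti s")
    case True
    then have "D x b \<le> c" using D_anti s by blast
    then have "D x b \<le> 2 * c + l + k" using c_nonneg l_ge_1 k_nonneg by linarith
    then show ?thesis using b by blast
  next
    case False
    obtain u1 where u1: "lo s \<le> u1" "u1 \<le> hi s" "\<not> anti (segment_of (lo s) u1 (smap s))"
      "\<And>t. t \<in> {lo s..u1} \<Longrightarrow> D (smap s (lo s)) (smap s t) \<le> c + l + k"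
      by (rule first_not_anti[OF s(1) los(1)]) (use False whole in auto)
    obtain \<tau> r where bn: "bottleneck s (lo s) u1 \<tau> r"
      using ex_bottleneck[OF s(1) _ u1(1-3)] by blast
    define e where "e = smap s \<tau>"
    have r: "0 \<le> r" and \<tau>: "\<tau> \<in> {lo s..hi s}" using bn u1 by (auto simp: bottleneck_def)
    have outside: "gap r \<le> d e (smap s t)" if "t \<in> {lo s..hi s}" "t \<le> lo s \<or> u1 \<le> t" for t
      using bn that unfolding bottleneck_def e_def by blast
    have near_e: "\<exists>z\<in>B. d z e \<le> r" if "linked j P B b x" "j \<le> 5" for B j
      using bn linked_mono[OF that order_refl] s unfolding bottleneck_def e_def by blast
    have eS: "e \<in> segment_image s" using \<tau> by (auto simp: e_def segment_image_def)
    have eM: "e \<in> M" using eS image_in[OF s(1)] by auto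
    have ex: "gap r \<le> d e x" and eb: "gap r \<le> d e b"
      using outside[of "lo s"] outside[of "hi s"] los u1 s by (auto simp: initial_def final_def)
    note gr = gap_bounds[OF r]
    \<comment> \<open>Large enough for the \<open>\<rho>\<close>-ball around \<open>e\<close> to
      contain the balls of any bottleneck of the second path (see \<open>near\<close> below), yet
      small against \<open>gap r\<close>.\<close>
    define \<rho> where "\<rho> = 8 * q * (r + 1)"
    have \<rho>: "0 \<le> q * r" "\<rho> = 8 * (q * r) + 8 * q" "r \<le> \<rho>"
    proof -
      show "0 \<le> q * r" "\<rho> = 8 * (q * r) + 8 * q" using q_bounds r by (auto simp: \<rho>_def algebra_simps)
      moreover have "1 * r \<le> q * r" using q_bounds r by (intro mult_right_mono) auto
      ultimately show "r \<le> \<rho>" using q_bounds by linarith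
    qed
    have ex_up: "d e x \<le> q * d x b + 2 * q" using near_initial[OF s(1) eS] s by simp
    have no_mixed: False if "x' \<in> ?S" "b' \<in> ?Q" "d x' e \<le> \<rho>" "d b' e \<le> \<rho>" for x' b'
      using near_minimal_gap[OF min subM s eS that(1,3,2,4)] ex gr(6) by (simp add: \<rho>_def)
    \<comment> \<open>Since \<open>r < gap r \<le> d e x \<le> q * d x b + 2 * q\<close>, the radius
      \<open>r\<close>, and with it \<open>\<rho>\<close>, is bounded in terms of
      \<open>d x b\<close>. The radius in the hypothesis \<open>far\<close> is made for
      this.\<close>
    have p4_near: "z = final p2 \<and> z = initial p3" if "z \<in> segment_image p4" "d z e \<le> \<rho>" for z
    proof (rule far[OF that(1)])
      have zM: "z \<in> M" using that image_in P by auto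
      define Q where "Q = q * d x b"
      define Q2 where "Q2 = q\<^sup>2 * d x b"
      define C where "C = q\<^sup>2"
      have "d z x \<le> \<rho> + d e x" using triangle[OF zM eM xM] that by linarith
      moreover have "d e x \<le> Q + 2 * q" using ex_up by (simp add: Q_def)
      moreover have "q * r \<le> q * d e x" using gr(1) ex q_bounds by (intro mult_left_mono) auto
      moreover have "q * d e x \<le> q * (q * d x b + 2 * q)" using ex_up q_bounds by (intro mult_left_mono) auto
      moreover have "q * (q * d x b + 2 * q) = Q2 + 2 * C"
        by (simp add: Q2_def C_def power2_eq_square algebra_simps)
      moreover have qC: "q \<le> C" using q_bounds mult_left_mono[of 1 q q] by (simp add: C_def power2_eq_square)
      moreover have "Q \<le> Q2" unfolding Q_def Q2_def C_def[symmetric] using qC by (intro mult_right_mono) auto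
      moreover have "0 \<le> Q2" by (simp add: Q2_def)
      ultimately have "d z x \<le> 40 * Q2 + 40 * C" using \<rho>(2) q_bounds(1) by linarith
      then show "d z x \<le> 40 * q\<^sup>2 * (d x b + 1)" by (simp add: Q2_def C_def algebra_simps)
    qed
    have hl1: "lo p1 \<in> {lo p1..hi p1}" "hi p1 \<in> {lo p1..hi p1}"
      and hl2: "lo p2 \<in> {lo p2..hi p2}" "hi p2 \<in> {lo p2..hi p2}"
      and hl3: "lo p3 \<in> {lo p3..hi p3}" "hi p3 \<in> {lo p3..hi p3}"
      using lo_le_hi P by auto
    note arc1 = arc_sub[OF P(1)] and arc2 = arc_sub[OF P(2)] and arc3 = arc_sub[OF P(3)]
      and arcs = arc_sub[OF s(1)]
    have final2_arc: "final p2 \<in> part p2 tb (hi p2)" using tb by (auto simp: part_def final_def)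
    have corner_links: "linked 1 P (part p1 (lo p1) tx) (initial p2) x"
      "linked 1 P (part p1 (hi p1) tx) (final p3) x"
      "linked 1 P (segment_image p4) (final p2) (initial p3)"
      "linked 1 P (segment_image p4) (initial p3) (final p2)"
      "linked 1 P (segment_image p3) (initial p3) (final p3)"
      using linked_arc_hi(3,4)[OF P(1) tx(1)] linked_segment[OF P(4)] linked_rev[OF P(4)]
        linked_segment[OF P(3)] corners tx(2) by auto
    have b_links: "linked 1 P (part p2 tb (lo p2)) b (initial p2)"
      "linked 1 P (part p2 tb (hi p2)) b (final p2)" "linked 1 P (part p2 (hi p2) tb) (final p2) b"
      using linked_arc_hi[OF P(2) tb(1)] tb(2) by auto
    \<comment> \<open>One loop runs back along \<open>p2\<close> and up \<open>p1\<close>, the other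
      along \<open>p2\<close>, \<open>p4\<close>, \<open>p3\<close> and back along
      \<open>p1\<close>. If the first came near \<open>e\<close> on \<open>p1\<close>, the second
      would do so on \<open>p2\<close> or \<open>p3\<close>, against \<open>no_mixed\<close>, or on
      the other half of \<open>p1\<close>, and then \<open>x\<close> would be near
      \<open>e\<close>.\<close>
    obtain b1 where b1: "b1 \<in> part p2 tb (lo p2)" "d b1 e \<le> r"
    proof -
      have "linked (1 + 1) P (part p2 tb (lo p2) \<union> part p1 (lo p1) tx) b x"
        by (rule linked_append[OF b_links(1) corner_links(1)])
      from near_e[OF this] obtain z1 where z1: "z1 \<in> part p2 tb (lo p2) \<union> part p1 (lo p1) tx" "d z1 e \<le> r"
          by auto
      have "linked (1 + 1 + 1 + 1) P
          (part p2 tb (hi p2) \<union> segment_image p4 \<union> segment_image p3 \<union> part p1 (hi p1) tx) b x"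
        by (rule linked_append[OF linked_append[OF linked_append[OF b_links(2) corner_links(3)]
          corner_links(5)] corner_links(2)])
      from near_e[OF this] obtain z2 where z2: "z2 \<in> part p2 tb (hi p2) \<union> segment_image p4 \<union> segment_image p3
          \<union> part p1 (hi p1) tx" "d z2 e \<le> r"
          by auto
      have z2': "z2 \<in> ?Q \<or> z2 \<in> part p1 (hi p1) tx"
        using z2 p4_near[of z2] \<rho>(3) arc2[OF tb(1) hl2(2)] final2_arc by fastforce
      have "z1 \<notin> part p1 (lo p1) tx"
      proof
        assume a: "z1 \<in> part p1 (lo p1) tx"
        then have z1S: "z1 \<in> ?S" using arc1[OF hl1(1) tx(1)] by blast
        show False
        proof (cases "z2 \<in> ?Q")
          case True
          then show False using no_mixed[OF z1S] z1 z2 \<rho> by fastforce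
        next
          case False
          then have "z2 \<in> part p1 tx (hi p1)" using z2' by (simp add: part_def min.commute max.commute)
          moreover have "z1 \<in> part p1 tx (lo p1)" using a by (simp add: part_def min.commute max.commute)
          ultimately have "d x e \<le> 3 * q * r + 2 * q"
            using between_arc[OF P(1) hl1(1) tx(1) hl1(2)] tx z1 z2 eM by auto
          then show False using gr(3) ex commute[of x e] by linarith
        qed
      qed
      then show thesis using z1 that by blast
    qed
    have b1Q: "b1 \<in> segment_image p2" using b1 arc2[OF tb(1) hl2(1)] by blast
    have p1_far: "\<rho> < d y e" if "y \<in> ?S" for y
      using no_mixed[OF that, of b1] b1Q b1 \<rho>(3) by fastforce
    have p2_past_b: "\<rho> < d y e" if "y \<in> part p2 tb (hi p2)" for y
    proof (rule ccontr)
      assume "\<not> \<rho> < d y e"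
      then have "d b e \<le> 3 * q * \<rho> + 2 * q"
        using between_arc[OF P(2) hl2(1) tb(1) hl2(2) _ _ b1(1) that eM] b1(2) \<rho>(3) tb by auto
      then show False using gr(5) eb commute[of b e] by (simp add: \<rho>_def)
    qed
    have sM: "segment_image s \<subseteq> M" using image_in[OF s(1)] .
    \<comment> \<open>Starting the minimisation at \<open>e\<close> keeps \<open>x2\<close> on the
      initial stretch of \<open>s\<close> up to \<open>u1\<close>, all of which is
      \<open>D\<close>-close to \<open>x\<close>.\<close>
    obtain x2 b2 where min2: "near_minimal (segment_image s) ?Q x2 b2"
      and x2b2: "d x2 b2 \<le> d e b1 + 1" and x2e: "d x2 e \<le> 2 * q * (d e b1 + 1)"
      using ex_near_minimal[OF sM subM(2) eS, of b1] b1Q by blast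
    have eb1: "d e b1 \<le> r" using b1 commute[of e b1] by simp
    have x2b2': "d x2 b2 \<le> r + 1" using x2b2 eb1 by linarith
    have "2 * q * (d e b1 + 1) \<le> 2 * q * (r + 1)" using eb1 q_bounds by (intro mult_left_mono) auto
    then have x2e': "d x2 e \<le> 2 * q * (r + 1)" "d x2 e \<le> 2 * (q * r) + 2 * q"
      using x2e by (auto simp: algebra_simps)
    obtain t2 where t2: "t2 \<in> {lo s..hi s}" "x2 = smap s t2"
      using min2 by (auto simp: near_minimal_def segment_image_def)
    have "t2 < u1" using outside[OF t2(1)] x2e'(1) gr(7) t2 commute[of x2 e] by fastforce
    then have Dxx2: "D x x2 \<le> c + l + k" using u1(4)[of t2] t2 s by (simp add: initial_def)
    have in2: "x2 \<in> M" "b2 \<in> M" "b2 \<in> ?Q" using min2 sM subM by (auto simp: near_minimal_def)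
    obtain s2 where s2: "s2 \<in> P" "initial s2 = x2" "final s2 = b2" using joined[OF in2(1,2)] by blast
    have "anti s2"
    proof (rule ccontr)
      assume na: "\<not> anti s2"
      have los2: "lo s2 \<in> {lo s2..hi s2}" "hi s2 \<in> {lo s2..hi s2}" using lo_le_hi[OF s2(1)] by auto
      obtain \<tau>2 r2 where bn2: "bottleneck s2 (lo s2) (hi s2) \<tau>2 r2"
        using ex_bottleneck[OF s2(1), of "lo s2" "hi s2"] na segment_of_whole[OF s2(1)] los2 by auto
      define e2 where "e2 = smap s2 \<tau>2"
      have r2: "0 \<le> r2" and \<tau>2: "\<tau>2 \<in> {lo s2..hi s2}" using bn2 by (auto simp: bottleneck_def)
      have near_e2: "\<exists>z\<in>B. d z e2 \<le> r2" if "linked j P B b2 x2" "j \<le> 5" for B j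
        using bn2 linked_mono[OF that order_refl] s2 unfolding bottleneck_def e2_def by blast
      have e2S: "e2 \<in> segment_image s2" using \<tau>2 by (auto simp: e2_def segment_image_def)
      have e2M: "e2 \<in> M" using e2S image_in[OF s2(1)] by auto
      have e2x2: "gap r2 \<le> d e2 x2" and e2b2: "gap r2 \<le> d e2 b2"
        using bn2 los2 s2 unfolding bottleneck_def e2_def by (auto simp: initial_def final_def)
      note gr2 = gap_bounds[OF r2]
      have "q * d x2 b2 \<le> q * (r + 1)" using x2b2' q_bounds by (intro mult_left_mono) auto
      then have e2x2_up: "d e2 x2 \<le> q * r + 3 * q"
        using near_initial[OF s2(1) e2S] s2 by (simp add: algebra_simps)
      \<comment> \<open>The unknown radius \<open>r2\<close> is below \<open>gap r2\<close>, hence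
        below the distance from \<open>e2\<close> to \<open>x2\<close>, and this is bounded through
        \<open>d x2 b2 \<le> r + 1\<close>.\<close>
      have near: "d y e \<le> \<rho>" if "y \<in> M" "d y e2 \<le> r2" for y
      proof -
        have "d y e \<le> d y e2 + d e2 x2 + d x2 e"
          using triangle[OF that(1) e2M eM] triangle[OF e2M in2(1) eM] by linarith
        then show ?thesis using that(2) gr2(1) e2x2 e2x2_up x2e'(2) \<rho>(1,2) by linarith
      qed
      have no_mixed2: False if "y \<in> segment_image s" "y' \<in> ?Q" "d y e2 \<le> r2" "d y' e2 \<le> r2" for y y'
        using near_minimal_gap[OF min2 sM subM(2) s2 e2S that(1,3,2,4)] e2x2 gr2(4) by linarith
      have not_both_s: False
        if "y \<in> part s t2 (lo s)" "y' \<in> part s t2 (hi s)" "d y e2 \<le> r2" "d y' e2 \<le> r2" for y y'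
      proof -
        have "d x2 e2 \<le> 3 * q * r2 + 2 * q"
          using between_arc[OF s(1) los(1) t2(1) los(2) _ _ that(1,2) e2M that(3,4)] t2 by auto
        then show False using e2x2 gr2(3) commute[of x2 e2] by linarith
      qed
      have not_both: False
        if p: "p \<in> P" "t3 \<in> {lo p..hi p}" "b2 = smap p t3"
          and y: "y \<in> part p t3 (lo p)" "y' \<in> part p t3 (hi p)" "d y e2 \<le> r2" "d y' e2 \<le> r2" for p t3 y y'
      proof -
        have "d b2 e2 \<le> 3 * q * r2 + 2 * q"
          using between_arc[OF p(1) _ p(2) _ _ _ y(1,2) e2M y(3,4)] p lo_le_hi[OF p(1)] by auto
        then show False using e2b2 gr2(3) commute[of b2 e2] by linarith
      qed
      have s_back: "linked 1 P (part s t2 (hi s)) b x2" "linked 1 P (part s t2 (lo s)) x x2"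
        using linked_arc_hi(3,4)[OF s(1) t2(1)] s t2 by (auto simp: part_def min.commute max.commute)
      have arc_comm: "part p u v = part p v u" for p u v by (simp add: part_def min.commute max.commute)
      \<comment> \<open>Two loops close \<open>s2\<close>, one returning through \<open>b\<close>
        and the far end of \<open>s\<close>, the other through \<open>x\<close> and its near end.
        After the sides far from \<open>e\<close> are discarded, each has a point near
        \<open>e2\<close> on \<open>s\<close> or on the side carrying \<open>b2\<close>. Both on
        \<open>s\<close> puts \<open>x2\<close> near \<open>e2\<close>, both on that side puts
        \<open>b2\<close> near \<open>e2\<close>, and one on each contradicts the choice of
        \<open>x2\<close> and \<open>b2\<close>.\<close>
      show False
      proof (cases "b2 \<in> segment_image p2")
        case True
        then obtain t3 where t3: "t3 \<in> {lo p2..hi p2}" "b2 = smap p2 t3" by (auto simp: segment_image_def)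
        have "t3 \<le> tb"
        proof (rule ccontr)
          assume "\<not> t3 \<le> tb"
          then have "b2 \<in> part p2 tb (hi p2)" using t3 tb by (auto simp: part_def)
          moreover have "d b2 e \<le> d b2 x2 + d x2 e" using triangle[OF in2(2,1) eM] .
          then have "d b2 e \<le> \<rho>"
            using x2b2' x2e'(2) commute[of b2 x2] \<rho> r q_bounds
              mult_right_mono[of 1 q r] by linarith
          ultimately show False using p2_past_b by fastforce
        qed
        have "linked (1 + 1) P (part p2 t3 tb \<union> part s t2 (hi s)) b2 x2"
          using linked_append[OF linked_arc[OF P(2) t3(1) tb(1)], folded tb(2), OF s_back(1)] t3(2)
          by simp
        from near_e2[OF this] obtain z1 where z1: "z1 \<in> part p2 t3 tb \<union> part s t2 (hi s)" "d z1 e2 \<le> r2"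
          by auto
        have z1': "z1 \<in> part p2 t3 (hi p2) \<or> z1 \<in> part s t2 (hi s)"
          using z1 \<open>t3 \<le> tb\<close> tb by (auto simp: part_def)
        have "linked (1 + 1 + 1) P (part p2 t3 (lo p2) \<union> part p1 (lo p1) tx \<union> part s t2 (lo s)) b2 x2"
          using linked_append[OF linked_append[OF linked_arc_hi(2)[OF P(2) t3(1)] corner_links(1)]
            s_back(2)] t3(2) by simp
        from near_e2[OF this] obtain z2 where z2: "z2 \<in> part p2 t3 (lo p2) \<union> part p1 (lo p1) tx \<union> part s t2 (lo s)"
          "d z2 e2 \<le> r2"
          by auto
        have "z2 \<notin> part p1 (lo p1) tx"
          using p1_far[of z2] near[of z2] z2(2) arc1[OF hl1(1) tx(1)] subM by fastforce
        then have z2': "z2 \<in> part p2 t3 (lo p2) \<or> z2 \<in> part s t2 (lo s)" using z2 by blast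
        show False
          using z1' z2' z1(2) z2(2) not_both_s not_both[OF P(2) t3] no_mixed2
            arc2[OF t3(1) hl2(1)] arc2[OF t3(1) hl2(2)] arcs[OF t2(1) los(1)] arcs[OF t2(1) los(2)]
          by blast
      next
        case False
        then obtain t3 where t3: "t3 \<in> {lo p3..hi p3}" "b2 = smap p3 t3"
          using in2(3) by (auto simp: segment_image_def)
        have "linked (1 + 1 + 1 + 1) P
            (part p3 t3 (lo p3) \<union> segment_image p4 \<union> part p2 (hi p2) tb \<union> part s t2 (hi s)) b2 x2"
          using linked_append[OF linked_append[OF linked_append[OF linked_arc_hi(2)[OF P(3) t3(1)]
            corner_links(4)] b_links(3)] s_back(1)] t3(2) by simp
        from near_e2[OF this] obtain z1 where z1: "z1 \<in> part p3 t3 (lo p3) \<union> segment_image p4 \<union> part p2 (hi p2) tb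
            \<union> part s t2 (hi s)" "d z1 e2 \<le> r2"
          by auto
        have z1M: "z1 \<in> M"
          using z1(1) arc3[OF t3(1) hl3(1)] arc2[OF hl2(2) tb(1)] arcs[OF t2(1) los(2)] subM sM
            image_in[OF P(4)] by blast
        have "z1 \<notin> part p2 (hi p2) tb"
          using p2_past_b[of z1] near[OF z1M z1(2)] arc_comm[of p2 tb] by fastforce
        moreover have "z1 \<notin> segment_image p4"
          using p4_near[of z1] near[OF z1M z1(2)] final2_arc p2_past_b[of z1] by fastforce
        ultimately have z1': "z1 \<in> part p3 t3 (lo p3) \<or> z1 \<in> part s t2 (hi s)" using z1 by blast
        have "linked (1 + 1 + 1) P (part p3 t3 (hi p3) \<union> part p1 (hi p1) tx \<union> part s t2 (lo s)) b2 x2"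
          using linked_append[OF linked_append[OF linked_arc_hi(1)[OF P(3) t3(1)] corner_links(2)]
            s_back(2)] t3(2) by simp
        from near_e2[OF this] obtain z2 where z2: "z2 \<in> part p3 t3 (hi p3) \<union> part p1 (hi p1) tx \<union> part s t2 (lo s)"
          "d z2 e2 \<le> r2"
          by auto
        have "z2 \<notin> part p1 (hi p1) tx"
          using p1_far[of z2] near[of z2] z2(2) arc1[OF hl1(2) tx(1)] subM by fastforce
        then have z2': "z2 \<in> part p3 t3 (hi p3) \<or> z2 \<in> part s t2 (lo s)" using z2 by blast
        show False
          using z1' z2' z1(2) z2(2) not_both_s not_both[OF P(3) t3] no_mixed2
            arc3[OF t3(1) hl3(1)] arc3[OF t3(1) hl3(2)] arcs[OF t2(1) los(1)] arcs[OF t2(1) los(2)]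
          by blast
      qed
    qed
    then have "D x2 b2 \<le> c" using D_anti s2 by blast
    then have "D x b2 \<le> 2 * c + l + k"
      using D_triangle[OF xM in2(1,2)] Dxx2 by linarith
    then show ?thesis using in2 by blast
  qed
qed

text \<open>The order of quantifiers is essential: \<open>m\<close> and \<open>L\<close> come from
  \<open>p1\<close> and its segment alone, and later stay fixed while \<open>p4\<close> runs through
  the translates of \<open>p1\<close>. The other three sides close up \<open>p1\<close>, so one of
  them passes near \<open>m\<close>; as \<open>p4\<close> cannot, a near-minimal pair can be sought
  starting from \<open>m\<close>.\<close>

lemma bottleneck_hat_close:
  assumes p1: "p1 \<in> P" and u: "lo p1 \<le> u0" "u0 \<le> u1" "u1 \<le> hi p1"
    and not_anti: "\<not> anti (segment_of u0 u1 (smap p1))"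
  obtains m L where "m \<in> M" "\<And>p2 p3 p4. \<lbrakk>p2 \<in> P; p3 \<in> P; p4 \<in> P; initial p1 = initial p2;
      final p2 = initial p4; final p4 = initial p3; final p3 = final p1;
      \<And>z. z \<in> segment_image p4 \<Longrightarrow> d z m \<le> L \<Longrightarrow> z = final p2 \<and> z = initial p3\<rbrakk> \<Longrightarrow>
      \<exists>t\<in>{u0..u1}. \<exists>b\<in>segment_image p2 \<union> segment_image p3. D (smap p1 t) b \<le> 2 * c + l + k"
proof -
  obtain \<tau> r where bn: "bottleneck p1 u0 u1 \<tau> r"
    using ex_bottleneck[OF p1 u not_anti] by blast
  define m where "m = smap p1 \<tau>"
  have r: "0 \<le> r" and \<tau>: "\<tau> \<in> {lo p1..hi p1}" using bn u by (auto simp: bottleneck_def)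
  have mS: "m \<in> segment_image p1" using \<tau> by (auto simp: m_def segment_image_def)
  have mM: "m \<in> M" using mS image_in[OF p1] by auto
  have outside: "gap r \<le> d m (smap p1 t)" if "t \<in> {lo p1..hi p1}" "t \<le> u0 \<or> u1 \<le> t" for t
    using bn that unfolding bottleneck_def m_def by blast
  have near_m: "\<exists>z\<in>B. d z m \<le> r" if "linked j P B (final p1) (initial p1)" "j \<le> 5" for B j
    using bn linked_mono[OF that order_refl] unfolding bottleneck_def m_def by blast
  \<comment> \<open>The first term is the radius demanded around \<open>x\<close>, given
    \<open>d x b \<le> r + 1\<close>; the second bounds the distance from \<open>x\<close> to
    \<open>m\<close>.\<close>
  define L where "L = 40 * q\<^sup>2 * (r + 2) + 2 * q * (r + 1)"
  have rL: "r \<le> L"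
  proof -
    have "1 \<le> q\<^sup>2" using q_bounds by simp
    then have "1 * (r + 2) \<le> 40 * q\<^sup>2 * (r + 2)" using r by (intro mult_right_mono) auto
    then have "r \<le> 40 * q\<^sup>2 * (r + 2)" by simp
    moreover have "0 \<le> 2 * q * (r + 1)" using q_bounds r by simp
    ultimately show ?thesis unfolding L_def by (rule add_increasing2[rotated])
  qed
  show thesis
  proof
    fix p2 p3 p4
    assume P: "p2 \<in> P" "p3 \<in> P" "p4 \<in> P"
      and corners: "initial p1 = initial p2" "final p2 = initial p4" "final p4 = initial p3"
        "final p3 = final p1"
      and far: "\<And>z. z \<in> segment_image p4 \<Longrightarrow> d z m \<le> L \<Longrightarrow> z = final p2 \<and> z = initial p3"
    let ?S = "segment_image p1" and ?Q = "segment_image p2 \<union> segment_image p3"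
    have subM: "?S \<subseteq> M" "?Q \<subseteq> M" using image_in P p1 by auto
    have links: "linked 1 P (segment_image p3) (final p1) (initial p3)"
      "linked 1 P (segment_image p4) (initial p3) (final p2)"
      "linked 1 P (segment_image p2) (final p2) (initial p1)"
      using linked_rev[OF P(1)] linked_rev[OF P(2)] linked_rev[OF P(3)] corners by auto
    have "linked (1 + 1 + 1) P (segment_image p3 \<union> segment_image p4 \<union> segment_image p2)
        (final p1) (initial p1)"
      by (rule linked_append[OF linked_append[OF links(1,2)] links(3)])
    from near_m[OF this] obtain z where
      z: "z \<in> segment_image p3 \<union> segment_image p4 \<union> segment_image p2" "d z m \<le> r" by auto
    have zQ: "z \<in> ?Q"
      using z far[of z] rL final_in[OF P(1)] by auto
    obtain x b where min: "near_minimal ?S ?Q x b"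
      and xb: "d x b \<le> d m z + 1" and xm: "d x m \<le> 2 * q * (d m z + 1)"
      using ex_near_minimal[OF subM mS zQ] by blast
    have mz: "d m z \<le> r" using z(2) commute[of m z] by simp
    have "2 * q * (d m z + 1) \<le> 2 * q * (r + 1)" using mz q_bounds by (intro mult_left_mono) auto
    then have xm': "d x m \<le> 2 * q * (r + 1)" using xm by linarith
    have xb': "d x b \<le> r + 1" using xb mz by linarith
    obtain t where t: "t \<in> {lo p1..hi p1}" "x = smap p1 t"
      using min by (auto simp: near_minimal_def segment_image_def)
    have "gap r > d x m" using xm' gap_bounds(7)[OF r] by linarith
    then have tu: "t \<in> {u0..u1}" using outside[OF t(1)] t(2) commute[of x m] by fastforce
    have xM: "x \<in> M" using t smap_in[OF p1] by auto
    have far': "z = final p2 \<and> z = initial p3"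
      if "z \<in> segment_image p4" "d z x \<le> 40 * q\<^sup>2 * (d x b + 1)" for z
    proof (rule far[OF that(1)])
      have "40 * q\<^sup>2 * (d x b + 1) \<le> 40 * q\<^sup>2 * (r + 2)" using xb' by (intro mult_left_mono) auto
      moreover have "d z m \<le> d z x + d x m"
        using triangle[of z x m] that(1) image_in[OF P(3)] xM mM by auto
      ultimately show "d z m \<le> L" using that(2) xm' unfolding L_def by linarith
    qed
    have "\<exists>b'\<in>?Q. D x b' \<le> 2 * c + l + k"
    proof (cases "b \<in> segment_image p2")
      case True
      then show ?thesis using near_minimal_hat_close[OF p1 P corners min True far'] by blast
    next
      case False
      then have b3: "b \<in> segment_image p3" using min by (auto simp: near_minimal_def)
      note rs1 = reversed_simps[OF lo_le_hi[OF p1]] and rs2 = reversed_simps[OF lo_le_hi[OF P(1)]]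
        and rs3 = reversed_simps[OF lo_le_hi[OF P(2)]] and rs4 = reversed_simps[OF lo_le_hi[OF P(3)]]
      \<comment> \<open>Reversing all sides exchanges the roles of \<open>p2\<close> and
        \<open>p3\<close>.\<close>
      have "\<exists>b'\<in>segment_image (reversed p3) \<union> segment_image (reversed p2). D x b' \<le> 2 * c + l + k"
      proof (rule near_minimal_hat_close[OF rev_in[OF p1] rev_in[OF P(2)] rev_in[OF P(1)] rev_in[OF P(3)]])
        show "near_minimal (segment_image (reversed p1))
            (segment_image (reversed p3) \<union> segment_image (reversed p2)) x b"
          using min unfolding rs1 rs2 rs3 by (simp add: Un_commute)
        show "b \<in> segment_image (reversed p3)" using b3 rs3 by simp
        show "z = final (reversed p3) \<and> z = initial (reversed p2)"
          if "z \<in> segment_image (reversed p4)" "d z x \<le> 40 * q\<^sup>2 * (d x b + 1)" for z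
          using far'[of z] that unfolding rs2 rs3 rs4 by blast
      qed (use corners in \<open>simp_all add: rs1 rs2 rs3 rs4\<close>)
      then show ?thesis unfolding rs2 rs3 by blast
    qed
    then show "\<exists>t\<in>{u0..u1}. \<exists>b\<in>?Q. D (smap p1 t) b \<le> 2 * c + l + k" using tu t by blast
  qed (rule mM)
qed

section \<open>Thin triangles and their consequences\<close>

definition thinness :: real where "thinness = 3 * c + 2 * l + 2 * k"

text \<open>A triangle is a quadrilateral whose side \<open>p4\<close> is constant at a corner,
  where the condition on \<open>p4\<close> holds trivially. The bottleneck is sought in a barely
  non-anti-contracting segment starting at \<open>z\<close>; reaching it costs
  \<open>c + l + k\<close> and going on to another side \<open>2 * c + l + k\<close>, which add up
  to \<open>thinness\<close>.\<close>

lemma thin_triangle: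
  assumes P: "p1 \<in> P" "p2 \<in> P" "p3 \<in> P"
    and corners: "initial p1 = initial p2" "final p2 = initial p3" "final p3 = final p1"
    and z: "z \<in> segment_image p1"
  shows "\<exists>b\<in>segment_image p2 \<union> segment_image p3. D z b \<le> thinness"
proof -
  obtain t where t: "t \<in> {lo p1..hi p1}" "z = smap p1 t" using z by (auto simp: segment_image_def)
  have zM: "z \<in> M" using z image_in[OF P(1)] by auto
  show ?thesis
  proof (cases "anti (segment_of t (hi p1) (smap p1))")
    case True
    then have "D z (final p1) \<le> c" using D_anti_sub[OF True, of t "hi p1"] t by (auto simp: final_def)
    then have "D z (final p3) \<le> thinness" using corners c_nonneg l_ge_1 k_nonneg by (simp add: thinness_def)
    then show ?thesis using final_in[OF P(3)] by blast
  next
    case False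
    obtain u1 where u1: "t \<le> u1" "u1 \<le> hi p1" "\<not> anti (segment_of t u1 (smap p1))"
      "\<And>t'. t' \<in> {t..u1} \<Longrightarrow> D (smap p1 t) (smap p1 t') \<le> c + l + k"
      using first_not_anti[OF P(1) t(1) False] by blast
    define p4 where "p4 = segment_of 0 0 (\<lambda>_::real. final p2)"
    have p4: "p4 \<in> P" using final_in[OF P(2)] image_in[OF P(2)] unfolding p4_def by (intro const_in) auto
    have p4': "initial p4 = final p2" "final p4 = final p2" "segment_image p4 = {final p2}"
      by (auto simp: p4_def initial_def final_def segment_image_def)
    have lot: "lo p1 \<le> t" using t by simp
    obtain t' b where tb: "t' \<in> {t..u1}" "b \<in> segment_image p2 \<union> segment_image p3"
      "D (smap p1 t') b \<le> 2 * c + l + k"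
      by (rule bottleneck_hat_close[OF P(1) lot u1(1-3)]) (use P p4 p4' corners in \<open>metis singletonD\<close>)
    have "smap p1 t' \<in> M" using smap_in[OF P(1)] tb u1 t by auto
    moreover have "b \<in> M" using tb image_in P by auto
    ultimately have "D z b \<le> thinness"
      using D_triangle[of z "smap p1 t'" b] zM u1(4)[OF tb(1)] tb(3) t(2) by (simp add: thinness_def)
    then show ?thesis using tb by blast
  qed
qed

text \<open>Each step of the induction uses the thin triangle on \<open>f 0\<close>,
  \<open>f j\<close>, \<open>f (Suc j)\<close>: one side is small by \<open>step\<close>, another by
  the induction hypothesis. The latter covers every special path between its endpoints, so the
  second side may be chosen freely. The term \<open>2 * q\<close> bounds loops at
  \<open>f 0\<close>.\<close>

lemma hat_small_chain:
  assumes f: "\<And>i. i \<le> N \<Longrightarrow> f i \<in> M" and C: "0 \<le> C"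
    and step: "\<And>i. i < N \<Longrightarrow> \<exists>h\<in>P. initial h = f i \<and> final h = f (Suc i) \<and>
      (\<forall>z\<in>segment_image h. D (f i) z \<le> C)"
  shows "j \<le> N \<Longrightarrow> h \<in> P \<Longrightarrow> initial h = f 0 \<Longrightarrow> final h = f j \<Longrightarrow> z \<in> segment_image h \<Longrightarrow>
    D (f 0) z \<le> real j * (C + thinness) + 2 * q"
proof (induction j arbitrary: h z)
  case 0
  have f0: "f 0 \<in> M" using f by simp
  have "d z (f 0) \<le> 2 * q" using near_initial[OF 0(2,5)] 0 f0 by simp
  moreover have "z \<in> M" using 0 image_in by blast
  ultimately show ?case using D_le[OF f0, of z] commute[of z "f 0"] by simp
next
  case (Suc j)
  have jN: "j < N" "j \<le> N" using Suc by auto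
  obtain p3 where p3: "p3 \<in> P" "initial p3 = f j" "final p3 = f (Suc j)"
    "\<forall>z\<in>segment_image p3. D (f j) z \<le> C"
    using step[OF jN(1)] by blast
  have fM: "f 0 \<in> M" "f j \<in> M" using f jN by auto
  obtain p2 where p2: "p2 \<in> P" "initial p2 = f 0" "final p2 = f j" using joined[OF fM] by blast
  obtain b where b: "b \<in> segment_image p2 \<union> segment_image p3" "D z b \<le> thinness"
    using thin_triangle[OF Suc.prems(2) p2(1) p3(1) _ _ _ Suc.prems(5)] Suc.prems p2 p3 by auto
  have zb: "z \<in> M" "b \<in> M" using Suc.prems b p2 p3 image_in by blast+
  have bz: "D b z \<le> thinness" using D_commute[OF zb] b by simp
  have IH: "D (f 0) y \<le> real j * (C + thinness) + 2 * q" if "y \<in> segment_image p2" for y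
    using Suc.IH[OF jN(2) p2 that] .
  have "D (f 0) b \<le> real j * (C + thinness) + 2 * q + C"
  proof (cases "b \<in> segment_image p2")
    case True
    then show ?thesis using IH C by fastforce
  next
    case False
    then have "D (f j) b \<le> C" using b p3 by blast
    moreover have "D (f 0) (f j) \<le> real j * (C + thinness) + 2 * q"
      using IH[OF final_in[OF p2(1)]] p2 by simp
    ultimately show ?thesis using D_triangle[OF fM zb(2)] by linarith
  qed
  then have "D (f 0) z \<le> real j * (C + thinness) + 2 * q + (C + thinness)"
    using D_triangle[OF fM(1) zb(2,1)] bz by linarith
  then show ?case by (simp add: algebra_simps)
qed

text \<open>Going along \<open>h\<close> in unit steps, the first point \<open>z\<close> at
  \<open>D\<close>-distance at least \<open>T\<close> from the start overshoots by at most
  \<open>l + k\<close>, so it is also at least \<open>T\<close> from the end. If \<open>p4\<close>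
  missed the ball, \<open>z\<close> would be \<open>thinness\<close>-close to \<open>p2\<close> or
  \<open>p3\<close>, hence within \<open>\<rho> + thinness < T\<close> of an end.\<close>

lemma far_pair_bottleneck:
  assumes h: "h \<in> P" and \<rho>: "0 \<le> \<rho>"
    and R: "2 * (\<rho> + thinness + 1) + l + k \<le> D (initial h) (final h)"
  obtains m L where "m \<in> M" "\<And>p2 p3 p4. \<lbrakk>p2 \<in> P; p3 \<in> P; p4 \<in> P; initial h = initial p2;
      final p2 = initial p4; final p4 = initial p3; final p3 = final h;
      \<And>z. z \<in> segment_image p2 \<Longrightarrow> D (initial h) z \<le> \<rho>;
      \<And>z. z \<in> segment_image p3 \<Longrightarrow> D (final h) z \<le> \<rho>\<rbrakk> \<Longrightarrow>
      \<exists>z\<in>segment_image p4. d z m \<le> L"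
proof -
  define T where "T = \<rho> + thinness + 1"
  have th: "0 \<le> thinness" "c \<le> thinness" "c + l + k + (2 * c + l + k) = thinness"
    using c_nonneg l_ge_1 k_nonneg by (auto simp: thinness_def)
  define v where "v i = min (lo h + real i) (hi h)" for i
  obtain N where "hi h - lo h \<le> real N" using real_arch_simple by blast
  then have vN: "v N = hi h" by (simp add: v_def)
  have v0: "v 0 = lo h" using lo_le_hi[OF h] by (simp add: v_def)
  have ends: "initial h \<in> M" "final h \<in> M" using initial_in final_in image_in h by blast+
  define i where "i = (LEAST i. T \<le> D (initial h) (smap h (v i)))"
  have "T \<le> 2 * T + l + k" using \<rho> th l_ge_1 k_nonneg by (simp add: T_def)
  also have "\<dots> \<le> D (initial h) (smap h (v N))"
    using R by (simp add: vN T_def final_def)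
  finally have "T \<le> D (initial h) (smap h (v N))" .
  then have i: "T \<le> D (initial h) (smap h (v i))"
    unfolding i_def by (rule LeastI)
  have "i \<noteq> 0"
  proof
    assume "i = 0"
    then have "T \<le> D (initial h) (initial h)" using i v0 by (simp add: initial_def)
    then show False using D_self[OF ends(1)] \<rho> th by (simp add: T_def)
  qed
  then obtain j where j: "i = Suc j" by (cases i) auto
  then have "\<not> T \<le> D (initial h) (smap h (v j))"
    unfolding i_def by (metis lessI not_less_Least)
  define t where "t = v i"
  define z where "z = smap h t"
  have dom: "v j \<in> {lo h..hi h}" "t \<in> {lo h..hi h}" using lo_le_hi[OF h] by (auto simp: v_def t_def)
  have zM: "z \<in> M" "smap h (v j) \<in> M" using smap_in[OF h] dom by (auto simp: z_def)
  have "\<bar>v j - t\<bar> \<le> 1" by (auto simp: v_def t_def j)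
  then have "l * \<bar>v j - t\<bar> \<le> l * 1" using l_ge_1 by (intro mult_left_mono) auto
  then have "D (smap h (v j)) z \<le> l + k"
    using upper[OF h dom] D_le[OF zM(2,1)] by (simp add: z_def)
  then have "D (initial h) z \<le> T + l + k"
    using D_triangle[OF ends(1) zM(2,1)] \<open>\<not> T \<le> _\<close> by linarith
  then have zy: "T \<le> D z (final h)"
    using D_triangle[OF ends(1) zM(1) ends(2)] R by (simp add: T_def)
  have xz: "T \<le> D (initial h) z" using i by (simp add: z_def t_def)
  have not_anti: "\<not> anti (segment_of t (hi h) (smap h))"
  proof
    assume "anti (segment_of t (hi h) (smap h))"
    then have "D z (final h) \<le> c"
      using D_anti_sub[of t "hi h" "smap h" t "hi h"] dom by (auto simp: z_def final_def)
    then show False using zy th \<rho> by (simp add: T_def)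
  qed
  obtain u1 where u1: "t \<le> u1" "u1 \<le> hi h" "\<not> anti (segment_of t u1 (smap h))"
    "\<And>t'. t' \<in> {t..u1} \<Longrightarrow> D (smap h t) (smap h t') \<le> c + l + k"
    using first_not_anti[OF h dom(2) not_anti] by blast
  have lot: "lo h \<le> t" using dom by simp
  obtain m L where mL: "m \<in> M" "\<And>p2 p3 p4. \<lbrakk>p2 \<in> P; p3 \<in> P; p4 \<in> P; initial h = initial p2;
      final p2 = initial p4; final p4 = initial p3; final p3 = final h;
      \<And>z. z \<in> segment_image p4 \<Longrightarrow> d z m \<le> L \<Longrightarrow> z = final p2 \<and> z = initial p3\<rbrakk> \<Longrightarrow>
      \<exists>t'\<in>{t..u1}. \<exists>b\<in>segment_image p2 \<union> segment_image p3. D (smap h t') b \<le> 2 * c + l + k"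
    by (rule bottleneck_hat_close[OF h lot u1(1-3)]) blast
  show thesis
  proof
    fix p2 p3 p4
    assume P: "p2 \<in> P" "p3 \<in> P" "p4 \<in> P" and corners: "initial h = initial p2"
      "final p2 = initial p4" "final p4 = initial p3" "final p3 = final h"
      and small: "\<And>z. z \<in> segment_image p2 \<Longrightarrow> D (initial h) z \<le> \<rho>"
        "\<And>z. z \<in> segment_image p3 \<Longrightarrow> D (final h) z \<le> \<rho>"
    show "\<exists>z\<in>segment_image p4. d z m \<le> L"
    proof (rule ccontr)
      assume "\<not> ?thesis"
      then have "\<exists>t'\<in>{t..u1}. \<exists>b\<in>segment_image p2 \<union> segment_image p3. D (smap h t') b \<le> 2 * c + l + k"
        by (intro mL(2)[OF P corners]) blast
      then obtain t' b where tb: "t' \<in> {t..u1}" "b \<in> segment_image p2 \<union> segment_image p3"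
        "D (smap h t') b \<le> 2 * c + l + k" by blast
      have bM: "b \<in> M" and t'M: "smap h t' \<in> M"
        using tb(2) image_in P apply blast using tb(1) smap_in[OF h] u1 dom by auto
      have zb: "D z b \<le> thinness"
        using D_triangle[OF zM(1) t'M bM] u1(4)[OF tb(1)] tb(3) th(3) by (simp add: z_def)
      have bz: "D b z \<le> thinness" using zb D_commute[OF zM(1) bM] by simp
      from tb(2) show False
      proof
        assume "b \<in> segment_image p2"
        then have "D (initial h) z \<le> \<rho> + thinness"
          using small(1) D_triangle[OF ends(1) bM zM(1)] bz by fastforce
        then show False using xz by (simp add: T_def)
      next
        assume "b \<in> segment_image p3"
        then have "D z (final h) \<le> \<rho> + thinness"
          using small(2) D_triangle[OF zM(1) bM ends(2)] D_commute[OF ends(2) bM] zb by fastforce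
        then show False using zy by (simp add: T_def)
      qed
    qed
  qed (rule mL(1))
qed

end

section \<open>The path metric of a graph\<close>


lemma pl_length_simps [simp]:
  "pl_length [] = 0" "pl_length ((e, s, t) # ps) = \<bar>s - t\<bar> + pl_length ps"
  "pl_length (ps @ qs) = pl_length ps + pl_length qs"
  by (simp_all add: pl_length_def)

lemma pl_length_nonneg: "0 \<le> pl_length ps"
  by (induction ps) auto

lemma pl_path_append:
  "pl_path X rv x ps y \<Longrightarrow> pl_path X rv y qs z \<Longrightarrow> pl_path X rv x (ps @ qs) z"
  by (induction ps arbitrary: x) auto

lemma pl_path_rev:
  "pl_path X rv x ps y \<Longrightarrow> \<exists>qs. pl_path X rv y qs x \<and> pl_length qs = pl_length ps"
proof (induction ps arbitrary: x)
  case Nil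
  then show ?case by (auto intro: exI[of _ "[]"])
next
  case (Cons a ps)
  obtain e s t where a: "a = (e, s, t)" by (cases a) auto
  obtain qs where qs: "pl_path X rv y qs (edge_point X rv e t)" "pl_length qs = pl_length ps"
    using Cons a by auto
  have "pl_path X rv (edge_point X rv e t) [(e, t, s)] x" using Cons.prems a by auto
  from pl_path_append[OF qs(1) this] show ?case
    using qs(2) a by (intro exI[of _ "qs @ [(e, t, s)]"]) auto
qed

definition pl_connected :: "('v, 'e) pre_digraph \<Rightarrow> ('e \<Rightarrow> 'e) \<Rightarrow> bool" where
  "pl_connected X rv \<longleftrightarrow>
     (\<forall>x\<in>realization X rv. \<forall>y\<in>realization X rv. \<exists>ps. pl_path X rv x ps y)"

lemma path_metric_le: "pl_path X rv x ps y \<Longrightarrow> path_metric X rv x y \<le> pl_length ps"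
  unfolding path_metric_def
  by (auto intro!: cInf_lower bdd_belowI[of _ 0] simp: pl_length_nonneg)

lemma path_metric_ge:
  assumes "pl_path X rv x ps y" "\<And>ps. pl_path X rv x ps y \<Longrightarrow> a \<le> pl_length ps"
  shows "a \<le> path_metric X rv x y"
  using assms unfolding path_metric_def by (auto intro!: cInf_greatest)

lemma path_metric_nonneg: "0 \<le> path_metric X rv x y"
proof (cases "\<exists>ps. pl_path X rv x ps y")
  case True
  then show ?thesis using path_metric_ge pl_length_nonneg by blast
qed (simp add: path_metric_def)

lemma path_metric_commute: "path_metric X rv x y = path_metric X rv y x"
proof (cases "\<exists>ps. pl_path X rv x ps y")
  case True
  have "path_metric X rv x y \<le> path_metric X rv y x" if "pl_path X rv y ps x" for x y ps
    using that by (rule path_metric_ge) (metis path_metric_le pl_path_rev)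
  then show ?thesis using True pl_path_rev by (metis antisym)
next
  case False
  then have "\<not> (\<exists>ps. pl_path X rv y ps x)" using pl_path_rev by metis
  with False show ?thesis by (simp add: path_metric_def)
qed

lemma path_metric_self: "path_metric X rv x x = 0"
  using path_metric_le[of X rv x "[]" x] path_metric_nonneg[of X rv x x] by simp

text \<open>The connecting paths are assumed since the default value 0 on the right-hand side could
  break the inequality.\<close>

lemma path_metric_triangle:
  assumes "pl_path X rv x ps0 y" "pl_path X rv y qs0 z"
  shows "path_metric X rv x z \<le> path_metric X rv x y + path_metric X rv y z"
proof -
  have "path_metric X rv x z - pl_length ps \<le> path_metric X rv y z" if ps: "pl_path X rv x ps y" for ps
    using assms(2)
  proof (rule path_metric_ge)
    fix qs assume "pl_path X rv y qs z"
    from path_metric_le[OF pl_path_append[OF ps this]]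
    show "path_metric X rv x z - pl_length ps \<le> pl_length qs" by simp
  qed
  then have "path_metric X rv x z - path_metric X rv y z \<le> path_metric X rv x y"
    by (intro path_metric_ge[OF assms(1)]) (simp add: diff_le_eq add.commute)
  then show ?thesis by simp
qed

text \<open>Upper bounds on the metric come from exhibiting a path. Lower bounds are bounds on an
  infimum over all paths and come from test functions of slope at most 1 along every arc.\<close>

lemma path_metric_lipschitz:
  fixes f :: "('v, 'e) point \<Rightarrow> real"
  assumes "pl_path X rv x ps0 y"
    and f: "\<And>e s t. e \<in> arcs X \<Longrightarrow> s \<in> {0..1} \<Longrightarrow> t \<in> {0..1} \<Longrightarrow>
      \<bar>f (edge_point X rv e s) - f (edge_point X rv e t)\<bar> \<le> \<bar>s - t\<bar>"
  shows "\<bar>f x - f y\<bar> \<le> path_metric X rv x y"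
  using assms(1)
proof (rule path_metric_ge)
  fix ps assume "pl_path X rv x ps y"
  then show "\<bar>f x - f y\<bar> \<le> pl_length ps"
  proof (induction ps arbitrary: x)
    case (Cons a ps)
    obtain e s t where a: "a = (e, s, t)" by (cases a) auto
    then have "\<bar>f (edge_point X rv e t) - f y\<bar> \<le> pl_length ps" using Cons by auto
    moreover have "\<bar>f x - f (edge_point X rv e t)\<bar> \<le> \<bar>s - t\<bar>" using f Cons.prems a by auto
    ultimately show ?case using a by simp
  qed simp
qed

lemma realization_cases:
  assumes "x \<in> realization X rv"
  obtains v where "v \<in> verts X" "x = Vert v"
  | e t where "e \<in> arcs X" "t \<in> {0..1}" "x = edge_point X rv e t"
  using assms by (auto simp: realization_def)

context bidirected_digraph begin

lemma realization_interior_cases: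
  assumes "x \<in> realization G arev"
  obtains v where "v \<in> verts G" "x = Vert v"
  | e t where "e \<in> arcs G" "0 < t" "t < 1" "x = edge_point G arev e t"
proof (cases rule: realization_cases[OF assms])
  case (2 e t)
  then have "e \<in> arcs G" "t = 0 \<or> t = 1 \<or> 0 < t \<and> t < 1" by auto
  then show ?thesis
    using that(1)[of "tail G e"] that(1)[of "head G e"] that(2)[of e t] 2
    by (auto simp: edge_point_def)
qed (use that in auto)

lemma edge_point_in: "e \<in> arcs G \<Longrightarrow> t \<in> {0..1} \<Longrightarrow> edge_point G arev e t \<in> realization G arev"
  by (auto simp: realization_def)

lemma Vert_in: "v \<in> verts G \<Longrightarrow> Vert v \<in> realization G arev"
  by (auto simp: realization_def)

lemma Vert_in_iff: "Vert v \<in> realization G arev \<longleftrightarrow> v \<in> verts G"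
proof
  assume "Vert v \<in> realization G arev"
  then show "v \<in> verts G"
    by (cases rule: realization_interior_cases) (auto simp: edge_point_def)
qed (rule Vert_in)

lemma near_vertex:
  assumes "x \<in> realization G arev"
  obtains v ps where "v \<in> verts G" "pl_path G arev x ps (Vert v)" "pl_length ps \<le> 1"
proof (cases rule: realization_cases[OF assms])
  case (1 v)
  then show ?thesis using that[of v "[]"] by auto
next
  case (2 e t)
  then show ?thesis using that[of "tail G e" "[(e, t, 0)]"] by (auto simp: edge_point_def)
qed

lemma pl_connectedI:
  assumes "\<And>u v. u \<in> verts G \<Longrightarrow> v \<in> verts G \<Longrightarrow> \<exists>ps. pl_path G arev (Vert u) ps (Vert v)"
  shows "pl_connected G arev"
  unfolding pl_connected_def
proof (intro ballI)
  fix x y assume x: "x \<in> realization G arev" and y: "y \<in> realization G arev"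
  obtain u ps where u: "u \<in> verts G" "pl_path G arev x ps (Vert u)" using near_vertex[OF x] by blast
  obtain v qs where v: "v \<in> verts G" "pl_path G arev y qs (Vert v)" using near_vertex[OF y] by blast
  obtain qs' where qs': "pl_path G arev (Vert v) qs' y" using pl_path_rev[OF v(2)] by blast
  obtain rs where "pl_path G arev (Vert u) rs (Vert v)" using assms u v by blast
  then show "\<exists>ps. pl_path G arev x ps y" using u(2) qs' pl_path_append by metis
qed

lemma connected_pl_connected:
  assumes "Digraph_Component.connected G"
  shows "pl_connected G arev"
proof (rule pl_connectedI)
  fix u v assume "u \<in> verts G" "v \<in> verts G"
  then have "(u, v) \<in> rtrancl_on (verts (with_proj (mk_symmetric G))) (arcs_ends (with_proj (mk_symmetric G)))"
    using assms unfolding connected_def strongly_connected_def reachable_def by auto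
  then show "\<exists>ps. pl_path G arev (Vert u) ps (Vert v)"
  proof (induction rule: rtrancl_on_induct)
    case base
    show ?case by (intro exI[of _ "[]"]) simp
  next
    case (step y z)
    obtain e where "e \<in> arcs G" "(y, z) = (tail G e, head G e) \<or> (y, z) = (head G e, tail G e)"
      using step(2) by (auto simp: parcs_mk_symmetric)
    then have "\<exists>qs. pl_path G arev (Vert y) qs (Vert z)"
      by (auto simp: edge_point_def intro: exI[of _ "[(e, 0, 1)]"] exI[of _ "[(e, 1, 0)]"])
    then show ?case using step(5) pl_path_append by metis
  qed
qed

text \<open>
  Which description of an interior point is chosen does not matter: the formula is invariant under
  exchanging \<open>e\<close> with \<open>arev e\<close> and \<open>t\<close> with \<open>1 - t\<close>.
\<close>

definition interpolate :: "('a \<Rightarrow> real) \<Rightarrow> ('a, 'b) point \<Rightarrow> real" where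
  "interpolate \<phi> p = (case p of Vert v \<Rightarrow> \<phi> v
     | Inner A \<Rightarrow> (case SOME a. a \<in> A of (e, t) \<Rightarrow> (1 - t) * \<phi> (tail G e) + t * \<phi> (head G e)))"

lemma interpolate_edge_point:
  assumes "e \<in> arcs G"
  shows "interpolate \<phi> (edge_point G arev e t) = (1 - t) * \<phi> (tail G e) + t * \<phi> (head G e)"
proof -
  define a where "a = (SOME a. a \<in> {(e, t), (arev e, 1 - t)})"
  have "a \<in> {(e, t), (arev e, 1 - t)}" unfolding a_def by (rule someI[of _ "(e, t)"]) simp
  then have "(case a of (e, t) \<Rightarrow> (1 - t) * \<phi> (tail G e) + t * \<phi> (head G e)) =
      (1 - t) * \<phi> (tail G e) + t * \<phi> (head G e)"
    using assms by auto
  then show ?thesis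
    by (auto simp: edge_point_def interpolate_def a_def)
qed

lemma interpolate_lipschitz:
  assumes conn: "pl_path G arev x ps0 y"
    and \<phi>: "\<And>e. e \<in> arcs G \<Longrightarrow> \<bar>\<phi> (tail G e) - \<phi> (head G e)\<bar> \<le> 1"
  shows "\<bar>interpolate \<phi> x - interpolate \<phi> y\<bar> \<le> path_metric G arev x y"
proof (rule path_metric_lipschitz[OF conn])
  fix e and s t :: real assume e: "e \<in> arcs G"
  have "interpolate \<phi> (edge_point G arev e s) - interpolate \<phi> (edge_point G arev e t) =
      (s - t) * (\<phi> (head G e) - \<phi> (tail G e))"
    unfolding interpolate_edge_point[OF e] by (simp add: algebra_simps)
  also have "\<bar>\<dots>\<bar> \<le> \<bar>s - t\<bar> * 1"
    unfolding abs_mult using \<phi>[OF e] by (intro mult_left_mono) auto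
  finally show "\<bar>interpolate \<phi> (edge_point G arev e s) - interpolate \<phi> (edge_point G arev e t)\<bar> \<le> \<bar>s - t\<bar>"
    by simp
qed

text \<open>
  The combinatorial distance from \<open>u\<close>, interpolated along the edges, is 1-Lipschitz. Giving
  unreachable vertices a value above the path metric makes \<open>v\<close> reachable.
\<close>

lemma path_metric_chain:
  assumes conn: "pl_path G arev (Vert u) ps0 (Vert v)"
  obtains N f where "real N \<le> path_metric G arev (Vert u) (Vert v)" "f 0 = u" "f N = v"
    "\<And>i. i < N \<Longrightarrow> \<exists>e\<in>arcs G. tail G e = f i \<and> head G e = f (Suc i)"
proof -
  define E where "E = {(tail G e, head G e) | e. e \<in> arcs G}"
  define B where "B = path_metric G arev (Vert u) (Vert v) + 1"
  define len where "len w = (LEAST n. (u, w) \<in> E ^^ n)" for w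
  define \<phi> where "\<phi> w = (if (u, w) \<in> E\<^sup>* then real (len w) else B)" for w
  have len: "(u, w) \<in> E ^^ len w" if "(u, w) \<in> E\<^sup>*" for w
  proof -
    have "\<exists>n. (u, w) \<in> E ^^ n" using that by (rule rtrancl_imp_relpow)
    then obtain n where "(u, w) \<in> E ^^ n" ..
    then show ?thesis unfolding len_def by (rule LeastI[where P = "\<lambda>n. (u, w) \<in> E ^^ n"])
  qed
  have len_Suc: "(u, z) \<in> E\<^sup>*" "len z \<le> Suc (len w)" if "(u, w) \<in> E\<^sup>*" "(w, z) \<in> E" for w z
  proof -
    have "(u, z) \<in> E ^^ Suc (len w)" using len[OF that(1)] that(2) by auto
    then show "len z \<le> Suc (len w)"
      unfolding len_def[of z] by (rule Least_le[where P = "\<lambda>n. (u, z) \<in> E ^^ n"])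
  qed (use that in auto)
  have "\<bar>\<phi> (tail G e) - \<phi> (head G e)\<bar> \<le> 1" if e: "e \<in> arcs G" for e
  proof -
    have E: "(tail G e, head G e) \<in> E" "(head G e, tail G e) \<in> E"
    proof -
      show "(tail G e, head G e) \<in> E" using e by (auto simp: E_def)
      show "(head G e, tail G e) \<in> E" unfolding E_def using e arev_in_arcs tail_arev head_arev
        by (intro CollectI exI[of _ "arev e"]) auto
    qed
    show ?thesis
    proof (cases "(u, tail G e) \<in> E\<^sup>*")
      case True
      then have *: "(u, head G e) \<in> E\<^sup>*" using len_Suc E by blast
      then show ?thesis
        using True len_Suc(2)[OF True E(1)] len_Suc(2)[OF * E(2)] by (auto simp: \<phi>_def)
    next
      case False
      then have "(u, head G e) \<notin> E\<^sup>*" using len_Suc(1)[OF _ E(2)] by blast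
      then show ?thesis using False by (simp add: \<phi>_def)
    qed
  qed
  then have "\<bar>interpolate \<phi> (Vert u) - interpolate \<phi> (Vert v)\<bar> \<le> path_metric G arev (Vert u) (Vert v)"
    by (rule interpolate_lipschitz[OF conn])
  moreover have "\<phi> u = 0"
  proof -
    have "len u = 0" unfolding len_def by (rule Least_eq_0) simp
    then show ?thesis by (simp add: \<phi>_def)
  qed
  ultimately have le: "\<phi> v \<le> path_metric G arev (Vert u) (Vert v)"
    by (simp add: interpolate_def)
  then have v: "(u, v) \<in> E\<^sup>*" by (auto simp: \<phi>_def B_def split: if_splits)
  obtain f where f: "f 0 = u" "f (len v) = v" "\<And>i. i < len v \<Longrightarrow> (f i, f (Suc i)) \<in> E"
    using len[OF v] unfolding relpow_fun_conv by blast
  have "\<exists>e\<in>arcs G. tail G e = f i \<and> head G e = f (Suc i)" if "i < len v" for i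
    using f(3)[OF that] unfolding E_def by auto
  then show thesis
    using that[of "len v" f] f(1,2) le v by (simp add: \<phi>_def)
qed

section \<open>Open edges and paths that avoid vertices\<close>

definition open_edge :: "'b \<Rightarrow> ('a, 'b) point set" where
  "open_edge e = {edge_point G arev e t | t. 0 < t \<and> t < 1}"

text \<open>
  These Lipschitz functions separate an interior point from all others and show that open edges
  are open.
\<close>

definition tent :: "'b \<Rightarrow> real \<Rightarrow> ('a, 'b) point \<Rightarrow> real" where
  "tent e0 t0 p = (case p of Vert v \<Rightarrow> 0
     | Inner A \<Rightarrow> (if \<exists>t. (e0, t) \<in> A
         then max 0 (min t0 (1 - t0) - \<bar>(THE t. (e0, t) \<in> A) - t0\<bar>) else 0))"

lemma edge_point_arev: "e \<in> arcs G \<Longrightarrow> edge_point G arev (arev e) (1 - t) = edge_point G arev e t"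
  by (auto simp: edge_point_def)

lemma tent_edge_point:
  assumes "e \<in> arcs G" "e0 \<in> arcs G" "0 < t0" "t0 < 1" "t \<in> {0..1}"
  shows "tent e0 t0 (edge_point G arev e t) =
    (if e = e0 then max 0 (min t0 (1 - t0) - \<bar>t - t0\<bar>)
     else if e = arev e0 then max 0 (min t0 (1 - t0) - \<bar>1 - t - t0\<bar>) else 0)"
proof (cases "t = 0 \<or> t = 1")
  case True
  then show ?thesis using assms by (auto simp: tent_def edge_point_def)
next
  case False
  have 1: "(THE s. e0 = e0 \<and> s = t \<or> e0 = arev e0 \<and> s = 1 - t) = t" for t
    using arev_neq[OF assms(2)] by auto
  have 2: "(THE s. (e0, s) \<in> {(e0, t), (arev e0, 1 - t)}) = t" for t
    using arev_neq[OF assms(2)] by (intro the_equality) auto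
  have 3: "(THE s. (e0, s) \<in> {(arev e0, t), (e0, 1 - t)}) = 1 - t" for t
    using arev_neq[OF assms(2)] by (intro the_equality) auto
  consider "e = e0" | "e = arev e0" "e \<noteq> e0" | "e \<noteq> e0" "e \<noteq> arev e0" by blast
  then show ?thesis
  proof cases
    case 1
    then show ?thesis using False 2[of t] by (auto simp: tent_def edge_point_def)
  next
    case 2
    then show ?thesis using False 3[of t] by (auto simp: tent_def edge_point_def)
  next
    case 3
    then have "e0 \<noteq> arev e" by auto
    then show ?thesis using False 3 by (auto simp: tent_def edge_point_def)
  qed
qed

lemma tent_lipschitz:
  assumes "e0 \<in> arcs G" "0 < t0" "t0 < 1" "pl_path G arev x ps0 y"
  shows "\<bar>tent e0 t0 x - tent e0 t0 y\<bar> \<le> path_metric G arev x y"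
  using assms(4)
proof (rule path_metric_lipschitz)
  fix e and s t :: real assume e: "e \<in> arcs G" "s \<in> {0..1}" "t \<in> {0..1}"
  show "\<bar>tent e0 t0 (edge_point G arev e s) - tent e0 t0 (edge_point G arev e t)\<bar> \<le> \<bar>s - t\<bar>"
  proof -
    have *: "\<bar>max 0 (m - \<bar>a\<bar>) - max 0 (m - \<bar>b\<bar>)\<bar> \<le> \<bar>a - b\<bar>" for m a b :: real
      by linarith
    show ?thesis
      unfolding tent_edge_point[OF e(1) assms(1-3) e(2)] tent_edge_point[OF e(1) assms(1-3) e(3)]
      using *[of "min t0 (1 - t0)" "s - t0" "t - t0"] *[of "min t0 (1 - t0)" "1 - s - t0" "1 - t - t0"]
      by (simp add: abs_minus_commute)
  qed
qed

lemma tent_pos: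
  assumes "e0 \<in> arcs G" "0 < t0" "t0 < 1" "y \<in> realization G arev" "0 < tent e0 t0 y"
  obtains t where "0 < t" "t < 1" "y = edge_point G arev e0 t"
    "tent e0 t0 y = max 0 (min t0 (1 - t0) - \<bar>t - t0\<bar>)"
proof (cases rule: realization_interior_cases[OF assms(4)])
  case (1 v)
  then show ?thesis using assms by (simp add: tent_def)
next
  case (2 e t)
  note te = tent_edge_point[OF 2(1) assms(1-3), of t]
  have "e = e0 \<or> e = arev e0" using te assms(5) 2 by (auto split: if_splits)
  then show ?thesis
  proof
    assume "e = arev e0"
    then show ?thesis
      using that[of "1 - t"] 2 te edge_point_arev[OF assms(1), of "1 - t"] arev_neq[OF assms(1)] by auto
  qed (use that[of t] 2 te in auto)
qed

lemma tent_center: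
  assumes "e0 \<in> arcs G" "0 < t0" "t0 < 1"
  shows "tent e0 t0 (edge_point G arev e0 t0) = min t0 (1 - t0)"
  using tent_edge_point[OF assms(1,1-3), of t0] assms by auto

text \<open>A tent separates an interior point from every other point; two distinct vertices are
  separated by interpolating the indicator function of one of them.\<close>

lemma path_metric_eq_0:
  assumes conn: "pl_connected G arev" and x: "x \<in> realization G arev" and y: "y \<in> realization G arev"
    and 0: "path_metric G arev x y = 0"
  shows "x = y"
proof -
  have *: "x = y" if x: "e \<in> arcs G" "0 < t" "t < 1" "x = edge_point G arev e t"
    and y: "y \<in> realization G arev" and 0: "path_metric G arev x y = 0" for x y e t
  proof -
    obtain ps where "pl_path G arev x ps y"
      using conn y edge_point_in[OF x(1), of t] x unfolding pl_connected_def by auto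
    then have "tent e t y = tent e t x"
      using tent_lipschitz[OF x(1-3)] 0 by fastforce
    then have ty: "tent e t y = min t (1 - t)" using tent_center x by simp
    then obtain s where "y = edge_point G arev e s" "tent e t y = max 0 (min t (1 - t) - \<bar>s - t\<bar>)"
      using tent_pos[OF x(1-3) y] x by (auto simp: min_def split: if_splits)
    moreover then have "s = t" using ty x by (auto simp: max_def min_def split: if_splits)
    ultimately show ?thesis using x by simp
  qed
  show ?thesis
  proof (cases rule: realization_interior_cases[OF x])
    case (2 e t)
    then show ?thesis using * y 0 by blast
  next
    case (1 u)
    show ?thesis
    proof (cases rule: realization_interior_cases[OF y])
      case (2 e t)
      then show ?thesis using *[OF 2 x] 0 path_metric_commute by metis
    next
      case v: (1 v)
      obtain ps where "pl_path G arev x ps y" using conn x y unfolding pl_connected_def by blast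
      then have "\<bar>interpolate (\<lambda>w. if w = u then 1 else 0) x - interpolate (\<lambda>w. if w = u then 1 else 0) y\<bar> \<le> 0"
        using interpolate_lipschitz[of x ps y "\<lambda>w. if w = u then 1 else 0"] 0 by auto
      then show ?thesis using 1 v by (auto simp: interpolate_def split: if_splits)
    qed
  qed
qed

lemma Metric_space_path_metric:
  assumes conn: "pl_connected G arev"
  shows "Metric_space (realization G arev) (path_metric G arev)"
proof
  fix x y z assume xyz: "x \<in> realization G arev" "y \<in> realization G arev" "z \<in> realization G arev"
  then show "path_metric G arev x z \<le> path_metric G arev x y + path_metric G arev y z"
    using conn path_metric_triangle unfolding pl_connected_def by metis
  show "path_metric G arev x y = 0 \<longleftrightarrow> x = y"
    using path_metric_eq_0[OF conn xyz(1,2)] path_metric_self by auto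
qed (simp_all add: path_metric_nonneg path_metric_commute)

lemma open_edge_diam:
  assumes "e \<in> arcs G" "x \<in> open_edge e" "y \<in> open_edge e"
  shows "path_metric G arev x y \<le> 1"
proof -
  obtain s t where "x = edge_point G arev e s" "0 < s" "s < 1" "y = edge_point G arev e t" "0 < t" "t < 1"
    using assms by (auto simp: open_edge_def)
  then show ?thesis
    using path_metric_le[of G arev x "[(e, s, t)]" y] assms(1) by auto
qed

lemma openin_open_edge:
  assumes conn: "pl_connected G arev" and e: "e \<in> arcs G"
  shows "openin (Metric_space.mtopology (realization G arev) (path_metric G arev)) (open_edge e)"
proof -
  interpret Metric_space "realization G arev" "path_metric G arev"
    by (rule Metric_space_path_metric[OF conn])
  have sub: "open_edge e \<subseteq> realization G arev" using edge_point_in[OF e] by (auto simp: open_edge_def)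
  moreover have "\<exists>r>0. mball x r \<subseteq> open_edge e" if "x \<in> open_edge e" for x
  proof -
    obtain t where t: "x = edge_point G arev e t" "0 < t" "t < 1" using \<open>x \<in> _\<close> by (auto simp: open_edge_def)
    \<comment> \<open>The tent centred at \<open>x\<close> has height \<open>min t (1 - t)\<close>,
      so by the Lipschitz bound it is still positive on the ball of that radius.\<close>
    have "y \<in> open_edge e" if y: "y \<in> mball x (min t (1 - t))" for y
    proof -
      have y': "y \<in> realization G arev" "path_metric G arev x y < min t (1 - t)" "x \<in> realization G arev"
        using y by auto
      obtain ps where "pl_path G arev x ps y" using conn y' unfolding pl_connected_def by blast
      then have "\<bar>tent e t x - tent e t y\<bar> < min t (1 - t)"
        using tent_lipschitz[OF e t(2,3)] y'(2) by fastforce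
      then have "0 < tent e t y" using tent_center[OF e t(2,3), folded t(1)] by linarith
      then show ?thesis using tent_pos[OF e t(2,3) y'(1)] by (auto simp: open_edge_def)
    qed
    then show ?thesis using t by (intro exI[of _ "min t (1 - t)"]) auto
  qed
  ultimately show ?thesis unfolding openin_mtopology by blast
qed

lemma open_edge_eq:
  assumes "e \<in> arcs G" "e' \<in> arcs G" "x \<in> open_edge e" "x \<in> open_edge e'"
  shows "open_edge e = open_edge e'"
proof -
  have rev: "open_edge (arev e) = open_edge e" if "e \<in> arcs G" for e
  proof -
    have "open_edge e \<subseteq> open_edge (arev e)" if "e \<in> arcs G" for e
    proof
      fix x assume "x \<in> open_edge e"
      then obtain t where "x = edge_point G arev e t" "0 < t" "t < 1" by (auto simp: open_edge_def)
      then show "x \<in> open_edge (arev e)"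
        using edge_point_arev[OF that, of t] unfolding open_edge_def by (intro CollectI exI[of _ "1 - t"]) auto
    qed
    from this[of e] this[of "arev e"] show ?thesis using that by auto
  qed
  obtain s t where "x = edge_point G arev e s" "0 < s" "s < 1" "x = edge_point G arev e' t" "0 < t" "t < 1"
    using assms unfolding open_edge_def by blast
  then have "e' = e \<or> e' = arev e"
    by (auto simp: edge_point_def doubleton_eq_iff)
  then show ?thesis using rev[OF assms(1)] by auto
qed

text \<open>Without its vertices the realization is a disjoint union of open edges, each of them an
  open set. A connected image avoiding vertices stays in one of these, of diameter at most 1.
  Continuity of special paths enters here.\<close>

lemma path_avoiding_vertices:
  fixes a b :: real
  assumes conn: "pl_connected G arev" and "a \<le> b"
    and cont: "continuous_map (top_of_set {a..b})
      (Metric_space.mtopology (realization G arev) (path_metric G arev)) h"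
    and avoid: "\<And>t. t \<in> {a..b} \<Longrightarrow> h t \<notin> range Vert"
  shows "path_metric G arev (h a) (h b) \<le> 1"
proof -
  interpret Metric_space "realization G arev" "path_metric G arev"
    by (rule Metric_space_path_metric[OF conn])
  let ?T = "mtopology"
  have h_in: "h t \<in> realization G arev" if "t \<in> {a..b}" for t
    using continuous_map_image_subset_topspace[OF cont] that by auto
  have edge: "\<exists>e\<in>arcs G. h t \<in> open_edge e" if t: "t \<in> {a..b}" for t
    using avoid[OF t] by (cases rule: realization_interior_cases[OF h_in[OF t]]) (auto simp: open_edge_def)
  obtain e where e: "e \<in> arcs G" "h a \<in> open_edge e" using edge[of a] \<open>a \<le> b\<close> by auto
  have S: "connectedin ?T (h ` {a..b})"
    by (rule connectedin_continuous_map_image[OF cont]) simp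
  \<comment> \<open>The index condition compares the sets, not the arcs, because \<open>e\<close>
    and \<open>arev e\<close> have the same open edge.\<close>
  define V where "V = \<Union> (open_edge ` {e' \<in> arcs G. open_edge e' \<noteq> open_edge e})"
  have "openin ?T (open_edge e)" using openin_open_edge[OF conn e(1)] .
  moreover have "openin ?T V" unfolding V_def using openin_open_edge[OF conn] by (intro openin_Union) auto
  moreover have "h ` {a..b} \<subseteq> open_edge e \<union> V" using edge by (force simp: V_def)
  moreover have "open_edge e \<inter> V \<inter> h ` {a..b} = {}"
    using open_edge_eq[OF e(1)] by (auto simp: V_def)
  moreover have "open_edge e \<inter> h ` {a..b} \<noteq> {}" using e(2) \<open>a \<le> b\<close> by auto
  ultimately have "V \<inter> h ` {a..b} = {}" using connectedinD[OF S] by blast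
  moreover have "h b \<in> h ` {a..b}" using \<open>a \<le> b\<close> by simp
  ultimately have "h b \<in> open_edge e" using \<open>h ` {a..b} \<subseteq> open_edge e \<union> V\<close> by blast
  then show ?thesis using open_edge_diam e by blast
qed

end

section \<open>The contraction graph\<close>


text \<open>A version of \<open>point_act\<close> between different graphs, so that the same
  estimates serve both the inclusion of \<open>X\<close> into the contraction graph and the group
  elements.\<close>

fun point_map :: "('v \<Rightarrow> 'w) \<Rightarrow> ('e \<Rightarrow> 'f) \<Rightarrow> ('v, 'e) point \<Rightarrow> ('w, 'f) point" where
  "point_map fv fe (Vert v) = Vert (fv v)"
| "point_map fv fe (Inner A) = Inner ((\<lambda>(e, t). (fe e, t)) ` A)"

definition graph_morphism ::
  "('v, 'e) pre_digraph \<Rightarrow> ('e \<Rightarrow> 'e) \<Rightarrow> ('w, 'f) pre_digraph \<Rightarrow> ('f \<Rightarrow> 'f) \<Rightarrow> ('v \<Rightarrow> 'w) \<Rightarrow> ('e \<Rightarrow> 'f) \<Rightarrow> bool"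
  where "graph_morphism X rv Y rw fv fe \<longleftrightarrow> (\<forall>v\<in>verts X. fv v \<in> verts Y) \<and>
    (\<forall>e\<in>arcs X. fe e \<in> arcs Y \<and> tail Y (fe e) = fv (tail X e) \<and> head Y (fe e) = fv (head X e) \<and>
      rw (fe e) = fe (rv e))"

lemma point_map_edge_point:
  assumes "graph_morphism X rv Y rw fv fe" "e \<in> arcs X"
  shows "point_map fv fe (edge_point X rv e t) = edge_point Y rw (fe e) t"
  using assms by (auto simp: graph_morphism_def edge_point_def)

lemma point_map_realization:
  assumes m: "graph_morphism X rv Y rw fv fe" and x: "x \<in> realization X rv"
  shows "point_map fv fe x \<in> realization Y rw"
proof (cases rule: realization_cases[OF x])
  case (1 v)
  then show ?thesis using m by (auto simp: graph_morphism_def realization_def)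
next
  case (2 e t)
  then have "point_map fv fe x = edge_point Y rw (fe e) t" "fe e \<in> arcs Y"
    using point_map_edge_point[OF m 2(1)] m by (auto simp: graph_morphism_def)
  then show ?thesis using 2 by (auto simp: realization_def)
qed

lemma point_map_pl_path:
  assumes m: "graph_morphism X rv Y rw fv fe" and "pl_path X rv x ps y"
  shows "\<exists>qs. pl_path Y rw (point_map fv fe x) qs (point_map fv fe y) \<and> pl_length qs = pl_length ps"
  using assms(2)
proof (induction ps arbitrary: x)
  case Nil
  then show ?case by (auto intro: exI[of _ "[]"])
next
  case (Cons a ps)
  obtain e s t where a: "a = (e, s, t)" by (cases a) auto
  have e: "e \<in> arcs X" "fe e \<in> arcs Y" using Cons.prems a m by (auto simp: graph_morphism_def)
  obtain qs where qs: "pl_path Y rw (edge_point Y rw (fe e) t) qs (point_map fv fe y)"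
    "pl_length qs = pl_length ps"
    using Cons.IH[of "edge_point X rv e t"] Cons.prems a point_map_edge_point[OF m e(1)] by auto
  show ?case
    using qs Cons.prems a e point_map_edge_point[OF m e(1)]
    by (intro exI[of _ "(fe e, s, t) # qs"]) auto
qed

lemma point_map_path_metric:
  assumes m: "graph_morphism X rv Y rw fv fe" and "pl_path X rv x ps0 y"
  shows "path_metric Y rw (point_map fv fe x) (point_map fv fe y) \<le> path_metric X rv x y"
  using assms(2)
proof (rule path_metric_ge)
  fix ps assume "pl_path X rv x ps y"
  then show "path_metric Y rw (point_map fv fe x) (point_map fv fe y) \<le> pl_length ps"
    using point_map_pl_path[OF m] path_metric_le by metis
qed

text \<open>The new arcs join distinct vertices, so exchanging the two ends never fixes one.\<close>

lemma contraction_bidirected: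
  assumes "bidirected_digraph X rv"
  shows "bidirected_digraph (contraction_graph X rv K n P) (contraction_rev X rv K n P)"
proof -
  interpret bidirected_digraph X rv by fact
  let ?Y = "contraction_graph X rv K n P" and ?r = "contraction_rev X rv K n P"
  have arc: "(\<exists>e. a = Inl e \<and> e \<in> arcs X) \<or> (\<exists>x y. a = Inr (x, y) \<and> x \<noteq> y \<and>
      x \<in> verts X \<and> y \<in> verts X \<and>
      (anti_contracting_pair X rv K n P x y \<or> anti_contracting_pair X rv K n P y x))"
    if "a \<in> arcs ?Y" for a
    using that by (auto simp: contraction_graph_def anti_contracting_pair_def)
  have rev_in: "map_sum rv prod.swap a \<in> arcs ?Y" if "a \<in> arcs ?Y" for a
    using that by (auto simp: contraction_graph_def)
  interpret Y: wf_digraph ?Y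
  proof
    fix a assume a: "a \<in> arcs ?Y"
    show "tail ?Y a \<in> verts ?Y" "head ?Y a \<in> verts ?Y"
      using arc[OF a] by (auto simp: contraction_graph_def)
  qed
  show ?thesis
  proof (rule Y.bidirected_digraphI)
    fix a assume a: "a \<in> arcs ?Y"
    show "?r a \<noteq> a" using arc[OF a] a arev_neq by (auto simp: contraction_rev_def)
    show "?r (?r a) = a" using arc[OF a] a rev_in[OF a] by (auto simp: contraction_rev_def)
    show "tail ?Y (?r a) = head ?Y a"
      using arc[OF a] a by (auto simp: contraction_rev_def) (auto simp: contraction_graph_def)
  qed (simp add: contraction_rev_def)
qed

section \<open>Special paths cut at vertices\<close>

locale graph_path_space = bidirected_digraph X rv +
  path_space "realization X rv" "path_metric X rv" P l k
  for X :: "('v, 'e) pre_digraph" and rv :: "'e \<Rightarrow> 'e" and P l k +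
  assumes conn: "pl_connected X rv"
    and continuous: "p \<in> P \<Longrightarrow> continuous_map (top_of_set {lo p..hi p}) mtopology (smap p)"
begin

lemma sub_avoiding_vertices:
  assumes p: "p \<in> P" and st: "s \<in> {lo p..hi p}" "t \<in> {lo p..hi p}" "s \<le> t"
    and avoid: "\<And>u. u \<in> {s..t} \<Longrightarrow> smap p u \<notin> range Vert"
  shows "path_metric X rv (smap p s) (smap p t) \<le> 1"
proof (rule path_avoiding_vertices[OF conn st(3) _ avoid])
  show "continuous_map (top_of_set {s..t}) mtopology (smap p)"
    by (rule continuous_map_from_subtopology_mono[OF continuous[OF p]]) (use st in auto)
qed

text \<open>Instead of attaining the infimum of the vertex parameters, a parameter less than 1 above
  it is taken. The last conclusion limits how far an almost first vertex can come after an almost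
  last one chosen separately.\<close>

lemma first_vertex:
  assumes p: "p \<in> P" and t0: "t0 \<in> {lo p..hi p}" "smap p t0 \<in> range Vert"
  obtains t1 where "t1 \<in> {lo p..hi p}" "smap p t1 \<in> range Vert"
    "path_metric X rv (initial p) (smap p t1) \<le> 1 + 2 * l + k"
    "\<And>t. t \<in> {lo p..hi p} \<Longrightarrow> smap p t \<in> range Vert \<Longrightarrow> t1 \<le> t + 1"
proof -
  define T where "T = {t \<in> {lo p..hi p}. smap p t \<in> range Vert}"
  define i where "i = Inf T"
  have T: "T \<noteq> {}" "bdd_below T" using t0 by (auto simp: T_def intro!: bdd_belowI[of _ "lo p"])
  obtain t1 where t1: "t1 \<in> T" "t1 < i + 1" using cInf_lessD[OF T(1), of "i + 1"] by (auto simp: i_def)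
  have i_le: "i \<le> t" if "t \<in> T" for t unfolding i_def using that T by (intro cInf_lower)
  have i_lo: "lo p \<le> i" unfolding i_def using T(1) by (intro cInf_greatest) (auto simp: T_def)
  \<comment> \<open>Unless \<open>u\<close> is already the start, it lies strictly before the
    infimum, so the path up to \<open>u\<close> meets no vertex; the remaining stretch to
    \<open>t1\<close> has parameter length at most 2.\<close>
  define u where "u = max (lo p) (i - 1)"
  have t1T: "t1 \<in> {lo p..hi p}" "smap p t1 \<in> range Vert" using t1 by (auto simp: T_def)
  have u: "u \<in> {lo p..hi p}" "u = lo p \<or> u < i" "\<bar>u - t1\<bar> \<le> 2"
    using i_le[OF t1(1)] t1 t1T i_lo by (auto simp: u_def)
  have lo: "lo p \<in> {lo p..hi p}" using lo_le_hi[OF p] by auto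
  have 1: "path_metric X rv (initial p) (smap p u) \<le> 1"
  proof (cases "u = lo p")
    case True
    then show ?thesis by (simp add: initial_def path_metric_self)
  next
    case False
    then have "smap p t \<notin> range Vert" if "t \<in> {lo p..u}" for t
      using i_le[of t] u that by (auto simp: T_def)
    then show ?thesis
      using sub_avoiding_vertices[OF p lo u(1)] u(1) by (auto simp: initial_def)
  qed
  have "l * \<bar>u - t1\<bar> \<le> l * 2" using u(3) l_ge_1 by (intro mult_left_mono) auto
  then have "path_metric X rv (smap p u) (smap p t1) \<le> 2 * l + k"
    using upper[OF p u(1) t1T(1)] by simp
  moreover have "initial p \<in> realization X rv" using smap_in[OF p lo] by (simp add: initial_def)
  ultimately have "path_metric X rv (initial p) (smap p t1) \<le> 1 + 2 * l + k"
    using triangle[of "initial p" "smap p u" "smap p t1"] 1 smap_in[OF p] u(1) t1T(1) by fastforce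
  then show thesis using that[OF t1T] i_le t1(2) by (force simp: T_def)
qed

lemma last_vertex:
  assumes p: "p \<in> P" and t0: "t0 \<in> {lo p..hi p}" "smap p t0 \<in> range Vert"
  obtains t1 where "t1 \<in> {lo p..hi p}" "smap p t1 \<in> range Vert"
    "path_metric X rv (final p) (smap p t1) \<le> 1 + 2 * l + k"
    "\<And>t. t \<in> {lo p..hi p} \<Longrightarrow> smap p t \<in> range Vert \<Longrightarrow> t \<le> t1 + 1"
proof -
  let ?r = "\<lambda>t. lo p + hi p - t"
  have lh: "lo (reversed p) = lo p" "hi (reversed p) = hi p" by (auto simp: reversed_def)
  have sm: "smap (reversed p) t = smap p (?r t)" if "t \<in> {lo p..hi p}" for t
    using that by (simp add: reversed_def)
  have r: "?r t \<in> {lo p..hi p}" if "t \<in> {lo p..hi p}" for t using that by auto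
  obtain t1 where t1: "t1 \<in> {lo p..hi p}" "smap p (?r t1) \<in> range Vert"
    "path_metric X rv (final p) (smap p (?r t1)) \<le> 1 + 2 * l + k"
    "\<And>t. t \<in> {lo p..hi p} \<Longrightarrow> smap (reversed p) t \<in> range Vert \<Longrightarrow> t1 \<le> t + 1"
    using first_vertex[OF rev_in[OF p], of "?r t0"] t0 r[OF t0(1)] sm reversed_simps(1)[OF lo_le_hi[OF p]]
    unfolding lh by (smt (verit, best))
  show thesis
  proof (rule that[OF r[OF t1(1)] t1(2,3)])
    fix t assume t: "t \<in> {lo p..hi p}" "smap p t \<in> range Vert"
    then show "t \<le> ?r t1 + 1" using t1(4)[OF r[OF t(1)]] sm[OF r[OF t(1)]] by auto
  qed
qed

end

locale contraction_graph_setting = graph_path_space X rv P l k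
  for X :: "('v, 'e) pre_digraph" and rv :: "'e \<Rightarrow> 'e" and P l k +
  fixes K :: "real \<Rightarrow> ennreal" and n :: nat
  assumes gauge_le: "0 \<le> r \<Longrightarrow> ennreal (2 * l * (gap r + k)) \<le> K r"
    and seven_le: "7 \<le> n"
begin

abbreviation "hat_graph \<equiv> contraction_graph X rv K n P"
abbreviation "hat_rev \<equiv> contraction_rev X rv K n P"

sublocale hat: bidirected_digraph hat_graph hat_rev
  by (rule contraction_bidirected) unfold_locales

definition hat_dist :: "('v, 'e) point \<Rightarrow> ('v, 'e) point \<Rightarrow> real" where
  "hat_dist x y = path_metric hat_graph hat_rev (point_map id Inl x) (point_map id Inl y)"

lemma hat_dist_Vert [simp]: "hat_dist (Vert u) (Vert v) = path_metric hat_graph hat_rev (Vert u) (Vert v)"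
  by (simp add: hat_dist_def)

lemma verts_hat [simp]: "verts hat_graph = verts X"
  by (simp add: contraction_graph_def)

lemma hat_embedding: "graph_morphism X rv hat_graph hat_rev id Inl"
  by (auto simp: graph_morphism_def contraction_graph_def contraction_rev_def)

lemma hat_connected: "pl_connected hat_graph hat_rev"
proof (rule hat.pl_connectedI)
  fix u v assume "u \<in> verts hat_graph" "v \<in> verts hat_graph"
  then obtain ps where "pl_path X rv (Vert u) ps (Vert v)"
    using conn[unfolded pl_connected_def, rule_format, OF Vert_in Vert_in] by auto
  then show "\<exists>ps. pl_path hat_graph hat_rev (Vert u) ps (Vert v)"
    using point_map_pl_path[OF hat_embedding] by fastforce
qed

lemma hat_metric_triangle:
  assumes "x \<in> realization hat_graph hat_rev" "y \<in> realization hat_graph hat_rev"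
    "z \<in> realization hat_graph hat_rev"
  shows "path_metric hat_graph hat_rev x z \<le>
    path_metric hat_graph hat_rev x y + path_metric hat_graph hat_rev y z"
  using assms hat_connected path_metric_triangle unfolding pl_connected_def by metis

lemma hat_dist_triangle:
  assumes "x \<in> realization X rv" "y \<in> realization X rv" "z \<in> realization X rv"
  shows "hat_dist x z \<le> hat_dist x y + hat_dist y z"
  unfolding hat_dist_def using assms point_map_realization[OF hat_embedding]
  by (intro hat_metric_triangle)

lemma hat_dist_commute: "hat_dist x y = hat_dist y x"
  unfolding hat_dist_def by (rule path_metric_commute)

lemma hat_dist_le:
  assumes "x \<in> realization X rv" "y \<in> realization X rv"
  shows "hat_dist x y \<le> path_metric X rv x y"
proof -
  obtain ps where "pl_path X rv x ps y" using conn assms unfolding pl_connected_def by blast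
  then show ?thesis unfolding hat_dist_def by (rule point_map_path_metric[OF hat_embedding])
qed

lemma hat_dist_anti_pair:
  assumes "anti_contracting_pair X rv K n P u v"
  shows "hat_dist (Vert u) (Vert v) \<le> 1"
proof (cases "u = v")
  case True
  then show ?thesis by (simp add: path_metric_self)
next
  case False
  then have "Inr (u, v) \<in> arcs hat_graph" using assms by (auto simp: contraction_graph_def)
  then have "pl_path hat_graph hat_rev (Vert u) [(Inr (u, v), 0, 1)] (Vert v)"
    by (auto simp: edge_point_def contraction_graph_def)
  then show ?thesis using path_metric_le by fastforce
qed

text \<open>Twice \<open>1 + 2 * l + k\<close> for cutting back the two ends to vertices, plus
  \<open>1 + l + k\<close> for the part between them.\<close>

definition anti_bound :: real where "anti_bound = 3 + 5 * l + 3 * k"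

text \<open>
  The definition of the contraction graph only speaks about special paths between vertices.
  An arbitrary one is cut back to its first and last vertex, up to a bounded error.
\<close>

lemma hat_dist_anti:
  assumes anti: "anti_contracting (realization X rv) (path_metric X rv) K n P h"
  shows "hat_dist (initial h) (final h) \<le> anti_bound"
proof -
  let ?d = "path_metric X rv" and ?M = "realization X rv"
  have h: "h \<in> P" using anti by (simp add: anti_contracting_def)
  have lo_hi: "lo h \<in> {lo h..hi h}" "hi h \<in> {lo h..hi h}" "lo h \<le> hi h" using lo_le_hi[OF h] by auto
  have ends: "initial h \<in> ?M" "final h \<in> ?M"
    using initial_in[OF h] final_in[OF h] image_in[OF h] by auto
  show ?thesis
  proof (cases "\<exists>t\<in>{lo h..hi h}. smap h t \<in> range Vert")
    case False
    then have "?d (initial h) (final h) \<le> 1"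
      using sub_avoiding_vertices[OF h lo_hi] by (auto simp: initial_def final_def)
    then have "hat_dist (initial h) (final h) \<le> 1" using hat_dist_le[OF ends] by linarith
    then show ?thesis using l_ge_1 k_nonneg by (simp add: anti_bound_def)
  next
    case True
    then obtain t0 where t0: "t0 \<in> {lo h..hi h}" "smap h t0 \<in> range Vert" by blast
    obtain s where s: "s \<in> {lo h..hi h}" "smap h s \<in> range Vert"
      "?d (initial h) (smap h s) \<le> 1 + 2 * l + k"
      "\<And>t. t \<in> {lo h..hi h} \<Longrightarrow> smap h t \<in> range Vert \<Longrightarrow> s \<le> t + 1"
      by (rule first_vertex[OF h t0]) blast
    obtain t where t: "t \<in> {lo h..hi h}" "smap h t \<in> range Vert"
      "?d (final h) (smap h t) \<le> 1 + 2 * l + k"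
      by (rule last_vertex[OF h t0]) blast
    have in_M: "smap h s \<in> ?M" "smap h t \<in> ?M" using smap_in[OF h] s t by auto
    \<comment> \<open>In the right order the two vertices form an anti-contracting pair. In the
      wrong order their parameters differ by at most 1, and the metric of \<open>X\<close>
      suffices.\<close>
    have "hat_dist (smap h s) (smap h t) \<le> 1 + l + k"
    proof (cases "s \<le> t")
      case True
      have "anti_contracting ?M ?d K n P (segment_of s t (smap h))"
        using anti_contracting_sub[of K n "lo h" "hi h" "smap h" s t] anti segment_of_whole[OF h] s t True by auto
      moreover obtain u v where uv: "smap h s = Vert u" "smap h t = Vert v" using s t by auto
      moreover have "u \<in> verts X" "v \<in> verts X"
        using in_M uv Vert_in_iff by auto
      ultimately have "anti_contracting_pair X rv K n P u v"
        using True unfolding anti_contracting_pair_def anti_contracting_def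
        by (auto intro!: bexI[of _ "segment_of s t (smap h)"] simp: initial_def final_def)
      then show ?thesis using hat_dist_anti_pair uv l_ge_1 k_nonneg by fastforce
    next
      case False
      then have "l * \<bar>s - t\<bar> \<le> l * 1" using s(4)[OF t(1,2)] l_ge_1 by (intro mult_left_mono) auto
      then show ?thesis
        using upper[OF h s(1) t(1)] hat_dist_le[OF in_M] by linarith
    qed
    moreover have "hat_dist (initial h) (smap h s) \<le> 1 + 2 * l + k"
      using hat_dist_le[OF ends(1) in_M(1)] s(3) by linarith
    moreover have "hat_dist (smap h t) (final h) \<le> 1 + 2 * l + k"
      using hat_dist_le[OF ends(2) in_M(2)] t(3) hat_dist_commute by simp
    ultimately show ?thesis
      using hat_dist_triangle[OF ends(1) in_M] hat_dist_triangle[OF ends(1) in_M(2) ends(2)]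
      by (simp add: anti_bound_def)
  qed
qed

sublocale contraction_setting "realization X rv" "path_metric X rv" P l k K n hat_dist anti_bound
proof unfold_locales
  show "0 \<le> anti_bound" using l_ge_1 k_nonneg by (simp add: anti_bound_def)
qed (use gauge_le seven_le hat_dist_triangle hat_dist_commute hat_dist_le hat_dist_anti in auto)

text \<open>For an old edge the endpoints have distance at most 1 in \<open>X\<close>, and
  \<open>near_initial\<close> gives \<open>3 * q\<close>. A new edge comes with an anti-contracting
  path, possibly to be reversed; its initial and final subsegments are anti-contracting too, which
  bounds the distance from each of its points to both ends.\<close>

lemma hat_edge_small:
  assumes a: "a \<in> arcs hat_graph"
  shows "\<exists>h\<in>P. initial h = Vert (tail hat_graph a) \<and> final h = Vert (head hat_graph a) \<and>
    (\<forall>z\<in>segment_image h. hat_dist (Vert (tail hat_graph a)) z \<le> anti_bound + 3 * q)"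
proof -
  have c0: "0 \<le> anti_bound" "1 \<le> q" using c_nonneg q_bounds by auto
  have pieces: "hat_dist (initial h) z \<le> anti_bound" "hat_dist z (final h) \<le> anti_bound"
    if a: "anti h" and z: "z \<in> segment_image h" for h z
  proof -
    have h: "h \<in> P" using a by (simp add: anti_contracting_def)
    have anti': "anti (segment_of (lo h) (hi h) (smap h))" using a segment_of_whole[OF h] by simp
    obtain t where "t \<in> {lo h..hi h}" "z = smap h t" using z by (auto simp: segment_image_def)
    then show "hat_dist (initial h) z \<le> anti_bound" "hat_dist z (final h) \<le> anti_bound"
      using D_anti_sub[OF anti', of "lo h" t] D_anti_sub[OF anti', of t "hi h"]
      by (auto simp: initial_def final_def)
  qed
  show ?thesis
  proof (cases a)
    case (Inl e)
    then have e: "e \<in> arcs X" using a by (auto simp: contraction_graph_def)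
    have M: "Vert (tail X e) \<in> realization X rv" "Vert (head X e) \<in> realization X rv"
      using e Vert_in by auto
    obtain h where h: "h \<in> P" "initial h = Vert (tail X e)" "final h = Vert (head X e)"
      using joined[OF M] by blast
    have "pl_path X rv (Vert (tail X e)) [(e, 0, 1)] (Vert (head X e))"
      using e by (auto simp: edge_point_def)
    then have d1: "path_metric X rv (Vert (tail X e)) (Vert (head X e)) \<le> 1"
      using path_metric_le by fastforce
    have "hat_dist (Vert (tail X e)) z \<le> anti_bound + 3 * q" if z: "z \<in> segment_image h" for z
    proof -
      have "q * path_metric X rv (Vert (tail X e)) (Vert (head X e)) \<le> q * 1"
        using d1 c0 by (intro mult_left_mono) auto
      then have "path_metric X rv z (Vert (tail X e)) \<le> 3 * q"
        using near_initial[OF h(1) z] h by simp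
      then show ?thesis
        using hat_dist_le[OF M(1), of z] image_in[OF h(1)] z c0 path_metric_commute[of X rv z] by auto
    qed
    then show ?thesis using h Inl by (auto simp: contraction_graph_def)
  next
    case (Inr p)
    obtain u v where p: "p = (u, v)" by (cases p) auto
    have "anti_contracting_pair X rv K n P u v \<or> anti_contracting_pair X rv K n P v u"
      using a Inr p by (auto simp: contraction_graph_def)
    then obtain h where h: "h \<in> P" "initial h = Vert u" "final h = Vert v"
      "\<forall>z\<in>segment_image h. hat_dist (Vert u) z \<le> anti_bound"
    proof
      assume "anti_contracting_pair X rv K n P u v"
      then obtain h where "h \<in> P" "initial h = Vert u" "final h = Vert v" "anti h"
        by (auto simp: anti_contracting_pair_def)
      then show thesis using that[of h] pieces(1)[of h] by simp
    next
      assume "anti_contracting_pair X rv K n P v u"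
      then obtain h where h: "h \<in> P" "initial h = Vert v" "final h = Vert u" "anti h"
        by (auto simp: anti_contracting_pair_def)
      note rs = reversed_simps[OF lo_le_hi[OF h(1)]]
      show thesis
        using that[of "reversed h"] rev_in[OF h(1)] h pieces(2)[OF h(4)] hat_dist_commute rs by simp
    qed
    then show ?thesis using Inr p c0 by (fastforce simp: contraction_graph_def)
  qed
qed

text \<open>The distance in the contraction graph is realised by a chain of at most \<open>B\<close>
  edges, old or new, through vertices of \<open>X\<close>. This turns \<open>B\<close> into the
  number of triangles used by \<open>hat_small_chain\<close>.\<close>

lemma hat_small_path:
  assumes uv: "u \<in> verts X" "v \<in> verts X" and "hat_dist (Vert u) (Vert v) \<le> B"
    and p: "p \<in> P" "initial p = Vert u" "final p = Vert v" and z: "z \<in> segment_image p"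
  shows "hat_dist (Vert u) z \<le> B * (anti_bound + 3 * q + thinness) + 2 * q"
proof -
  obtain ps where "pl_path hat_graph hat_rev (Vert u) ps (Vert v)"
    using hat_connected hat.Vert_in uv unfolding pl_connected_def by fastforce
  then obtain N f where f: "real N \<le> hat_dist (Vert u) (Vert v)" "f 0 = u" "f N = v"
    "\<And>i. i < N \<Longrightarrow> \<exists>e\<in>arcs hat_graph. tail hat_graph e = f i \<and> head hat_graph e = f (Suc i)"
    using hat.path_metric_chain unfolding hat_dist_Vert by metis
  have pos: "0 \<le> anti_bound + 3 * q" "0 \<le> thinness"
    using c_nonneg q_bounds l_ge_1 k_nonneg by (auto simp: thinness_def)
  have fV: "f i \<in> verts X" if "i \<le> N" for i
  proof (cases "i < N")
    case True
    then show ?thesis using f(4)[OF True] hat.tail_in_verts verts_hat by metis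
  qed (use that f uv in auto)
  have "hat_dist (Vert (f 0)) z \<le> real N * ((anti_bound + 3 * q) + thinness) + 2 * q"
  proof (rule hat_small_chain[where f = "\<lambda>i. Vert (f i)", OF _ pos(1) _ order_refl p(1) _ _ z])
    show "\<exists>h\<in>P. initial h = Vert (f i) \<and> final h = Vert (f (Suc i)) \<and>
        (\<forall>z\<in>segment_image h. hat_dist (Vert (f i)) z \<le> anti_bound + 3 * q)" if "i < N" for i
      using f(4)[OF that] hat_edge_small by metis
  qed (use fV Vert_in f p in auto)
  also have "real N * ((anti_bound + 3 * q) + thinness) \<le> B * (anti_bound + 3 * q + thinness)"
    using f(1) assms(3) add_nonneg_nonneg[OF pos] by (intro mult_right_mono) linarith+
  finally show ?thesis using f by simp
qed

end

section \<open>The group action\<close>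


lemma point_act_eq_point_map: "point_act av ae g = point_map (av g) (ae g)"
proof
  show "point_act av ae g p = point_map (av g) (ae g) p" for p by (cases p) auto
qed

locale contraction_action = contraction_graph_setting X rv P l k K n
  for X :: "('v, 'e) pre_digraph" and rv :: "'e \<Rightarrow> 'e" and P l k K n +
  fixes \<Gamma> :: "('g, 'm) monoid_scheme" and av :: "'g \<Rightarrow> 'v \<Rightarrow> 'v" and ae :: "'g \<Rightarrow> 'e \<Rightarrow> 'e"
  assumes group: "Group.group \<Gamma>"
    and action: "graph_action \<Gamma> X rv av ae"
    and invariant: "invariant_system \<Gamma> (point_act av ae) P"
    and proper: "proper_action \<Gamma> (realization X rv) (path_metric X rv) (point_act av ae)"
begin

abbreviation act :: "'g \<Rightarrow> ('v, 'e) point \<Rightarrow> ('v, 'e) point" where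
  "act \<equiv> point_act av ae"

abbreviation hat_act :: "'g \<Rightarrow> ('v, 'e + 'v \<times> 'v) point \<Rightarrow> ('v, 'e + 'v \<times> 'v) point" where
  "hat_act \<equiv> point_act av (contraction_arc_act av ae)"

lemma act_morphism:
  assumes "g \<in> carrier \<Gamma>"
  shows "graph_morphism X rv X rv (av g) (ae g)"
proof -
  interpret V: group_action \<Gamma> "verts X" av using action by (simp add: graph_action_def)
  interpret A: group_action \<Gamma> "arcs X" ae using action by (simp add: graph_action_def)
  show ?thesis
    unfolding graph_morphism_def
    using action assms V.element_image[OF assms] A.element_image[OF assms] by (auto simp: graph_action_def)
qed

lemma act_in: "g \<in> carrier \<Gamma> \<Longrightarrow> x \<in> realization X rv \<Longrightarrow> act g x \<in> realization X rv"
  using point_map_realization[OF act_morphism] by (simp add: point_act_eq_point_map)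

lemma act_le:
  assumes "g \<in> carrier \<Gamma>" "x \<in> realization X rv" "y \<in> realization X rv"
  shows "path_metric X rv (act g x) (act g y) \<le> path_metric X rv x y"
proof -
  obtain ps where "pl_path X rv x ps y" using conn assms unfolding pl_connected_def by blast
  then show ?thesis
    unfolding point_act_eq_point_map by (rule point_map_path_metric[OF act_morphism[OF assms(1)]])
qed

lemma act_inverse:
  assumes g: "g \<in> carrier \<Gamma>" and x: "x \<in> realization X rv"
  shows "act (inv\<^bsub>\<Gamma>\<^esub> g) (act g x) = x"
proof -
  interpret V: group_action \<Gamma> "verts X" av using action by (simp add: graph_action_def)
  interpret A: group_action \<Gamma> "arcs X" ae using action by (simp add: graph_action_def)
  have ig: "inv\<^bsub>\<Gamma>\<^esub> g \<in> carrier \<Gamma>" using g group by (rule group.inv_closed[rotated])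
  show ?thesis
  proof (cases rule: realization_cases[OF x])
    case (1 v)
    then show ?thesis using V.orbit_sym_aux[OF g] by simp
  next
    case (2 e t)
    have "ae g e \<in> arcs X" using A.element_image[OF g 2(1)] by simp
    then show ?thesis
      using 2 A.orbit_sym_aux[OF g 2(1)] point_map_edge_point[OF act_morphism[OF g]]
        point_map_edge_point[OF act_morphism[OF ig]]
      by (simp add: point_act_eq_point_map)
  qed
qed

lemma act_isometry:
  assumes g: "g \<in> carrier \<Gamma>" and xy: "x \<in> realization X rv" "y \<in> realization X rv"
  shows "path_metric X rv (act g x) (act g y) = path_metric X rv x y"
proof (rule antisym[OF act_le[OF assms]])
  have ig: "inv\<^bsub>\<Gamma>\<^esub> g \<in> carrier \<Gamma>" using g group by (rule group.inv_closed[rotated])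
  show "path_metric X rv x y \<le> path_metric X rv (act g x) (act g y)"
    using act_le[OF ig act_in[OF g xy(1)] act_in[OF g xy(2)]] act_inverse[OF g] xy by simp
qed

definition translate :: "'g \<Rightarrow> ('v, 'e) point segment \<Rightarrow> ('v, 'e) point segment" where
  "translate g p = segment_of (lo p) (hi p) (act g \<circ> smap p)"

lemma translate_in: "g \<in> carrier \<Gamma> \<Longrightarrow> p \<in> P \<Longrightarrow> translate g p \<in> P"
  using invariant by (simp add: invariant_system_def translate_def)

lemma translate_simps:
  assumes "p \<in> P"
  shows "lo (translate g p) = lo p" "hi (translate g p) = hi p"
    "initial (translate g p) = act g (initial p)" "final (translate g p) = act g (final p)"
    "segment_image (translate g p) = act g ` segment_image p"
    "segment_midpoint (translate g p) = act g (segment_midpoint p)"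
    "extent (translate g p) = extent p"
  using lo_le_hi[OF assms]
  by (auto simp: translate_def initial_def final_def segment_image_def segment_midpoint_def extent_def
      image_image)

lemma polygonal_line_translate:
  assumes g: "g \<in> carrier \<Gamma>" and ps: "polygonal_line n P x y ps"
  shows "polygonal_line n P (act g x) (act g y) (map (translate g) ps)"
proof -
  have P: "set ps \<subseteq> P" and ne: "ps \<noteq> []" using ps by (auto simp: polygonal_line_def)
  have "successively (\<lambda>p q. final (translate g p) = initial (translate g q)) ps"
  proof (rule successively_mono)
    show "successively (\<lambda>p q. final p = initial q) ps" using ps by (simp add: polygonal_line_def)
  qed (use P in \<open>auto simp: translate_simps subset_eq\<close>)
  moreover have "hd ps \<in> P" "last ps \<in> P" using P ne by auto
  ultimately show ?thesis
    using ps translate_in[OF g] by (auto simp: polygonal_line_def successively_map hd_map last_map translate_simps)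
qed

text \<open>A midthin piece of the translate is the translate of a piece \<open>p\<close> of
  \<open>h\<close>. Lines closing \<open>p\<close> are pushed forward by \<open>g\<close>, and their
  points in the ball are pulled back because \<open>g\<close> is an isometry; so \<open>p\<close>
  would be midthin.\<close>

lemma anti_translate:
  assumes g: "g \<in> carrier \<Gamma>" and h: "anti h"
  shows "anti (translate g h)"
  unfolding anti_contracting_def
proof (intro conjI ballI notI)
  have hP: "h \<in> P" using h by (simp add: anti_contracting_def)
  then show "translate g h \<in> P" by (rule translate_in[OF g])
  fix q' assume q': "q' \<in> subsegments (translate g h)"
    and mid: "midthin (realization X rv) (path_metric X rv) K n P q'"
  obtain s t where st: "q' = segment_of s t (smap (translate g h))" "lo h \<le> s" "s \<le> t" "t \<le> hi h"
    using q' by (auto simp: subsegments_def translate_simps[OF hP])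
  define p where "p = segment_of s t (smap h)"
  have p: "p \<in> P" "p \<in> subsegments h"
    unfolding p_def using segment_of_in[OF hP st(2-4)] st(2-4) by (auto simp: subsegments_def)
  have "q' = translate g p"
    using st by (auto simp: translate_def p_def segment_of_def fun_eq_iff restrict_def)
  then obtain r where r: "0 \<le> r" "K r \<le> ennreal (extent p)"
    "\<And>ps. polygonal_line n P (act g (final p)) (act g (initial p)) ps \<Longrightarrow>
      (\<Union>p\<in>set ps. segment_image p) \<inter> mcball (act g (segment_midpoint p)) r \<noteq> {}"
    using mid translate_simps[OF p(1)] by (auto simp: midthin_def)
  have mp: "segment_midpoint p \<in> realization X rv"
    using smap_in[OF p(1)] lo_le_hi[OF p(1)] by (auto simp: segment_midpoint_def)
  have "(\<Union>p\<in>set ps. segment_image p) \<inter> mcball (segment_midpoint p) r \<noteq> {}"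
    if ps: "polygonal_line n P (final p) (initial p) ps" for ps
  proof -
    obtain z where z: "z \<in> (\<Union>p\<in>set (map (translate g) ps). segment_image p)"
      "z \<in> mcball (act g (segment_midpoint p)) r"
      using r(3)[OF polygonal_line_translate[OF g ps]] by blast
    have P: "set ps \<subseteq> P" using ps by (auto simp: polygonal_line_def)
    obtain a w where w: "a \<in> set ps" "w \<in> segment_image a" "z = act g w"
      using z(1) P translate_simps(5) by fastforce
    have wM: "w \<in> realization X rv" using w P image_in by blast
    have "path_metric X rv (segment_midpoint p) w \<le> r"
      using z(2) w(3) act_isometry[OF g mp wM] by simp
    then show ?thesis using w mp wM by auto
  qed
  then have "midthin (realization X rv) (path_metric X rv) K n P p"
    using p(1) r(1,2) by (auto simp: midthin_def)
  then show False using h p(2) by (auto simp: anti_contracting_def)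
qed

lemma anti_pair_translate:
  assumes g: "g \<in> carrier \<Gamma>" and "anti_contracting_pair X rv K n P u v"
  shows "anti_contracting_pair X rv K n P (av g u) (av g v)"
proof -
  obtain h where h: "h \<in> P" "initial h = Vert u" "final h = Vert v" "anti h"
    using assms by (auto simp: anti_contracting_pair_def)
  have "initial (translate g h) = Vert (av g u)" "final (translate g h) = Vert (av g v)"
    using h translate_simps[OF h(1)] by auto
  then show ?thesis
    using translate_in[OF g h(1)] anti_translate[OF g h(4)] assms act_morphism[OF g]
    unfolding anti_contracting_pair_def by (auto simp: graph_morphism_def)
qed

lemma hat_act_morphism:
  assumes g: "g \<in> carrier \<Gamma>"
  shows "graph_morphism hat_graph hat_rev hat_graph hat_rev (av g) (contraction_arc_act av ae g)"
proof -
  interpret V: group_action \<Gamma> "verts X" av using action by (simp add: graph_action_def)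
  have arc: "contraction_arc_act av ae g a \<in> arcs hat_graph" if "a \<in> arcs hat_graph" for a
  proof (cases a)
    case (Inl e)
    then show ?thesis
      using that act_morphism[OF g] by (auto simp: contraction_graph_def contraction_arc_act_def graph_morphism_def)
  next
    case (Inr p)
    obtain u v where p: "p = (u, v)" by (cases p)
    have uv: "u \<noteq> v" "anti_contracting_pair X rv K n P u v \<or> anti_contracting_pair X rv K n P v u"
      using that Inr p by (auto simp: contraction_graph_def)
    then have "u \<in> verts X" "v \<in> verts X" by (auto simp: anti_contracting_pair_def)
    then have "av g u \<noteq> av g v" using uv(1) V.inj_prop[OF g] by (auto dest: inj_onD)
    then show ?thesis
      using uv(2) anti_pair_translate[OF g] Inr p
      by (auto simp: contraction_graph_def contraction_arc_act_def)
  qed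
  show ?thesis
    unfolding graph_morphism_def
  proof (intro conjI ballI)
    fix v assume "v \<in> verts hat_graph"
    then show "av g v \<in> verts hat_graph" using act_morphism[OF g] by (simp add: graph_morphism_def)
  next
    fix a assume a: "a \<in> arcs hat_graph"
    show "contraction_arc_act av ae g a \<in> arcs hat_graph" by (rule arc[OF a])
    have a_cases: "(\<exists>e\<in>arcs X. a = Inl e) \<or> (\<exists>u v. a = Inr (u, v))"
      using a by (auto simp: contraction_graph_def)
    then show "tail hat_graph (contraction_arc_act av ae g a) = av g (tail hat_graph a)"
      "head hat_graph (contraction_arc_act av ae g a) = av g (head hat_graph a)"
      using act_morphism[OF g] by (auto simp: contraction_graph_def contraction_arc_act_def graph_morphism_def)
    show "hat_rev (contraction_arc_act av ae g a) = contraction_arc_act av ae g (hat_rev a)"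
      using a_cases act_morphism[OF g] arc[OF a] a
      by (auto simp: contraction_rev_def contraction_arc_act_def graph_morphism_def)
  qed
qed

text \<open>The vertex is chosen once for \<open>x\<close>; its translates then serve for all
  \<open>g x\<close>, because \<open>g\<close> acts on the contraction graph by a morphism.\<close>

lemma near_vertex_equivariant:
  assumes x: "x \<in> realization hat_graph hat_rev"
  obtains v where "v \<in> verts X" "path_metric hat_graph hat_rev x (Vert v) \<le> 1"
    "\<And>g. g \<in> carrier \<Gamma> \<Longrightarrow> path_metric hat_graph hat_rev (hat_act g x) (Vert (av g v)) \<le> 1"
proof -
  obtain v ps where v: "v \<in> verts hat_graph" "pl_path hat_graph hat_rev x ps (Vert v)" "pl_length ps \<le> 1"
    using hat.near_vertex[OF x] by blast
  have 1: "path_metric hat_graph hat_rev x (Vert v) \<le> 1" using path_metric_le[OF v(2)] v(3) by linarith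
  have "path_metric hat_graph hat_rev (hat_act g x) (Vert (av g v)) \<le> 1" if g: "g \<in> carrier \<Gamma>" for g
    using point_map_path_metric[OF hat_act_morphism[OF g] v(2)] 1 by (simp add: point_act_eq_point_map)
  then show thesis using that v(1) 1 by simp
qed

lemma hat_nonuniformly_acylindrical:
  "nonuniformly_acylindrical \<Gamma> (realization hat_graph hat_rev) (path_metric hat_graph hat_rev) hat_act"
  unfolding nonuniformly_acylindrical_def
proof (intro allI impI)
  fix \<epsilon> :: real assume \<epsilon>: "0 < \<epsilon>"
  let ?M = "realization X rv" and ?d = "path_metric X rv"
  let ?H = "realization hat_graph hat_rev" and ?hd = "path_metric hat_graph hat_rev"
  \<comment> \<open>If \<open>g\<close> moves \<open>x\<close> by less than
    \<open>\<epsilon>\<close>, it moves a vertex within 1 of \<open>x\<close> by at most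
    \<open>\<epsilon> + 2\<close>; \<open>hat_small_path\<close> then bounds a special path joining
    the vertex to its image.\<close>
  define \<rho> where "\<rho> = (\<epsilon> + 2) * (anti_bound + 3 * q + thinness) + 2 * q"
  \<comment> \<open>The threshold of \<open>far_pair_bottleneck\<close>, plus 2 for replacing
    \<open>x\<close> and \<open>y\<close> by nearby vertices. It depends on
    \<open>\<epsilon>\<close> but not on \<open>x\<close> and \<open>y\<close>.\<close>
  define R where "R = 2 * (\<rho> + thinness + 1) + l + k + 2"
  have pos: "0 \<le> anti_bound + 3 * q + thinness" "0 \<le> thinness" "1 \<le> q"
    using c_nonneg q_bounds l_ge_1 k_nonneg by (auto simp: thinness_def)
  then have \<rho>: "0 \<le> \<rho>" using \<epsilon> by (simp add: \<rho>_def)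
  have "0 < R" using \<rho> pos l_ge_1 k_nonneg by (simp add: R_def)
  moreover have "finite {g \<in> carrier \<Gamma>. ?hd x (hat_act g x) < \<epsilon> \<and> ?hd y (hat_act g y) < \<epsilon>}"
    if x: "x \<in> ?H" and y: "y \<in> ?H" and far: "R \<le> ?hd x y" for x y
  proof -
    obtain u where u: "u \<in> verts X" "?hd x (Vert u) \<le> 1"
      "\<And>g. g \<in> carrier \<Gamma> \<Longrightarrow> ?hd (hat_act g x) (Vert (av g u)) \<le> 1"
      using near_vertex_equivariant[OF x] by blast
    obtain v where v: "v \<in> verts X" "?hd y (Vert v) \<le> 1"
      "\<And>g. g \<in> carrier \<Gamma> \<Longrightarrow> ?hd (hat_act g y) (Vert (av g v)) \<le> 1"
      using near_vertex_equivariant[OF y] by blast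
    have uvM: "Vert u \<in> ?M" "Vert v \<in> ?M" and uvH: "Vert u \<in> ?H" "Vert v \<in> ?H"
      using u(1) v(1) Vert_in hat.Vert_in by auto
    obtain h where h: "h \<in> P" "initial h = Vert u" "final h = Vert v" using joined[OF uvM] by blast
    have hd_comm: "?hd a b = ?hd b a" for a b by (rule path_metric_commute)
    have "?hd x y \<le> ?hd x (Vert u) + (?hd (Vert u) (Vert v) + ?hd (Vert v) y)"
      using hat_metric_triangle[OF x uvH(1) y] hat_metric_triangle[OF uvH y] by linarith
    then have "2 * (\<rho> + thinness + 1) + l + k \<le> hat_dist (initial h) (final h)"
      using far u(2) v(2) hd_comm[of "Vert v" y] h by (simp add: R_def)
    from far_pair_bottleneck[OF h(1) \<rho> this] obtain m L where mL: "m \<in> ?M"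
      "\<And>p2 p3 p4. \<lbrakk>p2 \<in> P; p3 \<in> P; p4 \<in> P; initial h = initial p2;
        final p2 = initial p4; final p4 = initial p3; final p3 = final h;
        \<And>z. z \<in> segment_image p2 \<Longrightarrow> hat_dist (initial h) z \<le> \<rho>;
        \<And>z. z \<in> segment_image p3 \<Longrightarrow> hat_dist (final h) z \<le> \<rho>\<rbrakk> \<Longrightarrow>
        \<exists>z\<in>segment_image p4. ?d z m \<le> L"
      by blast
    \<comment> \<open>If \<open>g w\<close> is near \<open>m\<close> for some \<open>w\<close> on
      \<open>h\<close>, then so is \<open>g m\<close>, because \<open>d (g w) (g m) = d w m\<close>
      is at most \<open>B\<close> whatever \<open>w\<close> is.\<close>
    define B where "B = q * ?d (Vert u) (Vert v) + 2 * q + ?d (Vert u) m"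
    have near_m: "?d w m \<le> B" if w: "w \<in> segment_image h" for w
      using near_initial[OF h(1) w] triangle[of w "Vert u" m] image_in[OF h(1)] w uvM(1) mL(1) h
      by (auto simp: B_def)
    have "?d m (act g m) \<le> max 0 (L + B)"
      if g: "g \<in> carrier \<Gamma>" and gx: "?hd x (hat_act g x) < \<epsilon>" and gy: "?hd y (hat_act g y) < \<epsilon>" for g
    proof -
      have gH: "hat_act g z \<in> ?H" if "z \<in> ?H" for z
        using point_map_realization[OF hat_act_morphism[OF g] that] by (simp add: point_act_eq_point_map)
      have gV: "av g z \<in> verts X" if "z \<in> verts X" for z
        using act_morphism[OF g] that by (simp add: graph_morphism_def)
      have moved: "hat_dist (Vert z) (Vert (av g z)) \<le> \<epsilon> + 2"
        if "z \<in> verts X" "a \<in> ?H" "?hd a (Vert z) \<le> 1" "?hd (hat_act g a) (Vert (av g z)) \<le> 1"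
          "?hd a (hat_act g a) < \<epsilon>" for z a
      proof -
        have zH: "Vert z \<in> ?H" "Vert (av g z) \<in> ?H" using that(1) gV hat.Vert_in by auto
        have "?hd (Vert z) (Vert (av g z)) \<le>
            ?hd (Vert z) a + (?hd a (hat_act g a) + ?hd (hat_act g a) (Vert (av g z)))"
          using hat_metric_triangle[OF zH(1) that(2) zH(2)]
            hat_metric_triangle[OF that(2) gH[OF that(2)] zH(2)] by linarith
        then show ?thesis using that hd_comm[of "Vert z" a] by simp
      qed
      have side: "\<exists>p\<in>P. initial p = Vert z \<and> final p = Vert (av g z) \<and>
          (\<forall>w\<in>segment_image p. hat_dist (Vert z) w \<le> \<rho>)"
        if z: "z \<in> verts X" "hat_dist (Vert z) (Vert (av g z)) \<le> \<epsilon> + 2" for z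
      proof -
        obtain p where p: "p \<in> P" "initial p = Vert z" "final p = Vert (av g z)"
          using joined[of "Vert z" "Vert (av g z)"] Vert_in z(1) gV by blast
        then show ?thesis
          using hat_small_path[OF z(1) gV[OF z(1)] z(2) p] unfolding \<rho>_def by blast
      qed
      obtain p2 where p2: "p2 \<in> P" "initial p2 = Vert u" "final p2 = Vert (av g u)"
        "\<And>w. w \<in> segment_image p2 \<Longrightarrow> hat_dist (Vert u) w \<le> \<rho>"
        using side[OF u(1) moved[OF u(1) x u(2) u(3)[OF g] gx]] by blast
      obtain p3 where p3: "p3 \<in> P" "initial p3 = Vert v" "final p3 = Vert (av g v)"
        "\<And>w. w \<in> segment_image p3 \<Longrightarrow> hat_dist (Vert v) w \<le> \<rho>"
        using side[OF v(1) moved[OF v(1) y v(2) v(3)[OF g] gy]] by blast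
      note rs = reversed_simps[OF lo_le_hi[OF p3(1)]] and ts = translate_simps[OF h(1)]
      \<comment> \<open>The quadrilateral runs from \<open>u\<close> to \<open>g u\<close> along
        \<open>p2\<close>, to \<open>g v\<close> along the translate of \<open>h\<close>, and back
        to \<open>v\<close> along the reverse of \<open>p3\<close>.\<close>
      have "\<exists>z\<in>segment_image (translate g h). ?d z m \<le> L"
        by (rule mL(2)[OF p2(1) rev_in[OF p3(1)] translate_in[OF g h(1)]])
          (use p2 p3 h in \<open>simp_all add: rs ts\<close>)
      then obtain w where w: "w \<in> segment_image h" "?d (act g w) m \<le> L" using ts by auto
      have wM: "w \<in> ?M" using w image_in[OF h(1)] by blast
      have "?d m (act g m) \<le> ?d m (act g w) + ?d (act g w) (act g m)"
        using triangle[OF mL(1) act_in[OF g wM] act_in[OF g mL(1)]] .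
      also have "\<dots> \<le> L + B"
        using w near_m[OF w(1)] act_isometry[OF g wM mL(1)] path_metric_commute[of X rv m] by simp
      finally show ?thesis by simp
    qed
    then have "{g \<in> carrier \<Gamma>. ?hd x (hat_act g x) < \<epsilon> \<and> ?hd y (hat_act g y) < \<epsilon>} \<subseteq>
        {g \<in> carrier \<Gamma>. ?d m (act g m) \<le> max 0 (L + B)}" by blast
    moreover have "finite {g \<in> carrier \<Gamma>. ?d m (act g m) \<le> max 0 (L + B)}"
      using proper mL(1) unfolding proper_action_def by (meson max.cobounded1)
    ultimately show ?thesis by (rule finite_subset)
  qed
  ultimately show "\<exists>R>0. \<forall>x\<in>?H. \<forall>y\<in>?H. R \<le> ?hd x y \<longrightarrow>
      finite {g \<in> carrier \<Gamma>. ?hd x (hat_act g x) < \<epsilon> \<and> ?hd y (hat_act g y) < \<epsilon>}"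
    by blast
qed

end

section \<open>From path systems to the full gauge\<close>

lemma path_system_graph_path_space:
  assumes X: "bidirected_digraph X rv" and conn: "pl_connected X rv"
    and P: "path_system (realization X rv) (path_metric X rv) P" and undir: "undirected P"
  obtains l k where "graph_path_space X rv P l k"
proof -
  interpret bidirected_digraph X rv by fact
  interpret Metric_space "realization X rv" "path_metric X rv"
    by (rule Metric_space_path_metric[OF conn])
  obtain l0 k0 where lk0: "\<forall>p\<in>P. lo p \<le> hi p \<and> smap p \<in> extensional {lo p..hi p} \<and>
      improved_quasi_geodesic (realization X rv) (path_metric X rv) l0 k0 {lo p..hi p} (smap p)"
    using P unfolding path_system_def by blast
  \<comment> \<open>The bounds \<open>1 \<le> l\<close> and \<open>0 \<le> k\<close> are part of
    being a quasi-geodesic, hence known only through a member of \<open>P\<close>. The maxima secure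
    them in general and change nothing once \<open>P\<close> has a member.\<close>
  define l where "l = max 1 l0"
  define k where "k = max 0 k0"
  have lk: "l = l0" "k = k0" if "p \<in> P" for p
    using lk0 that by (auto simp: l_def k_def improved_quasi_geodesic_def quasi_geodesic_def)
  have iqg: "lo p \<le> hi p" "smap p \<in> extensional {lo p..hi p}"
    "improved_quasi_geodesic (realization X rv) (path_metric X rv) l k {lo p..hi p} (smap p)"
    if "p \<in> P" for p
    using lk0 lk[OF that] that by auto
  have "graph_path_space X rv P l k"
  proof unfold_locales
    show "1 \<le> l" "0 \<le> k" by (auto simp: l_def k_def)
    show "pl_connected X rv" by fact
  next
    fix p assume p: "p \<in> P"
    show "lo p \<le> hi p" "smap p \<in> extensional {lo p..hi p}" "subsegments p \<subseteq> P" "reversed p \<in> P"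
      using iqg[OF p] P undir p by (auto simp: path_system_def undirected_def)
    show "continuous_map (top_of_set {lo p..hi p}) mtopology (smap p)"
      using iqg(3)[OF p] by (simp add: improved_quasi_geodesic_def)
    fix t assume t: "t \<in> {lo p..hi p}"
    then show "smap p t \<in> realization X rv"
      using iqg(3)[OF p] by (auto simp: improved_quasi_geodesic_def quasi_geodesic_def)
    fix s assume "s \<in> {lo p..hi p}"
    then show "(1 / l) * \<bar>s - t\<bar> - k \<le> path_metric X rv (smap p s) (smap p t)"
      "path_metric X rv (smap p s) (smap p t) \<le> l * \<bar>s - t\<bar> + k"
      using iqg(3)[OF p] t unfolding improved_quasi_geodesic_def quasi_geodesic_def by blast+
  next
    fix x a assume "x \<in> realization X rv"
    then show "segment_of a a (\<lambda>_. x) \<in> P" using P by (auto simp: path_system_def)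
  next
    fix x y assume "x \<in> realization X rv" "y \<in> realization X rv"
    then show "\<exists>p\<in>P. initial p = x \<and> final p = y" using P by (auto simp: path_system_def)
  qed
  then show thesis by (rule that)
qed

theorem theorem1p5:
  fixes G :: "('g, 'm) monoid_scheme"
    and X :: "('v, 'e) pre_digraph"
    and rv :: "'e \<Rightarrow> 'e"
    and av :: "'g \<Rightarrow> 'v \<Rightarrow> 'v"
    and ae :: "'g \<Rightarrow> 'e \<Rightarrow> 'e"
    and P :: "('v, 'e) point segment set"
  assumes "group G"
    and "bidirected_digraph X rv"
    and "Digraph_Component.connected X"
    and "graph_action G X rv av ae"
    and "proper_action G (realization X rv) (path_metric X rv) (point_act av ae)"
    and "path_system (realization X rv) (path_metric X rv) P"
    and "undirected P"
    and "invariant_system G (point_act av ae) P"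
  shows "\<exists>K0. contraction_gauge K0 \<and> full_gauge K0 \<and>
    (\<forall>K n. contraction_triple (realization X rv) (path_metric X rv) K n P \<and> (\<forall>r\<ge>0. K r \<ge> K0 r) \<longrightarrow>
      nonuniformly_acylindrical G
        (realization (contraction_graph X rv K n P) (contraction_rev X rv K n P))
        (path_metric (contraction_graph X rv K n P) (contraction_rev X rv K n P))
        (point_act av (contraction_arc_act av ae)))"
proof -
  have conn: "pl_connected X rv"
    using bidirected_digraph.connected_pl_connected[OF assms(2,3)] .
  obtain l k where "graph_path_space X rv P l k"
    by (rule path_system_graph_path_space[OF assms(2) conn assms(6,7)])
  then interpret graph_path_space X rv P l k .
  \<comment> \<open>The lower bound on the gauge required by \<open>contraction_setting\<close>. It
    involves only the constants \<open>l\<close> and \<open>k\<close> of \<open>P\<close>, so it is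
    fixed before \<open>K\<close> and \<open>n\<close>.\<close>
  define K0 where "K0 r = ennreal (2 * l * (gap r + k))" for r
  have "contraction_gauge K0"
    unfolding contraction_gauge_def mono_on_def K0_def gap_def
    using l_ge_1 by (auto intro!: ennreal_leI mult_left_mono)
  moreover have "full_gauge K0" by (simp add: full_gauge_def K0_def)
  moreover have "nonuniformly_acylindrical G
        (realization (contraction_graph X rv K n P) (contraction_rev X rv K n P))
        (path_metric (contraction_graph X rv K n P) (contraction_rev X rv K n P))
        (point_act av (contraction_arc_act av ae))"
    if "contraction_triple (realization X rv) (path_metric X rv) K n P" "\<forall>r\<ge>0. K0 r \<le> K r" for K n
  proof -
    interpret group G by fact
    interpret contraction_action X rv P l k K n G av ae
    proof unfold_locales
      show "ennreal (2 * l * (gap r + k)) \<le> K r" if "0 \<le> r" for r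
        using \<open>\<forall>r\<ge>0. K0 r \<le> K r\<close> that by (simp add: K0_def)
      show "7 \<le> n" using that by (simp add: contraction_triple_def)
    qed (use assms in auto)
    show ?thesis by (rule hat_nonuniformly_acylindrical)
  qed
  ultimately show ?thesis by blast
qed

end
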